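(* Let $\mathcal{D}$ be a deformation space, with vertical set $\mathcal{M}$ and Betti number $b_1(\mathcal{D})$. (1) The set $\mathcal{M}$ is finite. If $T\in\mathcal{D}$, the number $s$ of vertices of $\Gamma=T/G$ satisfies $s\ge|\mathcal{M}|$. (2) If $T\in\mathcal{D}$ is reduced, or only BF-reduced, then $s\le 2|\mathcal{M}|+2b_1(\mathcal{D})-2$.
   Context: $G$ is a finitely generated group. A $G$-tree is a metric simplicial tree $T$ with an isometric action of $G$ by simplicial automorphisms without inversions, always assumed minimal (no proper $G$-invariant subtree); $G$-trees are considered up to equivariant isometry. $G_v,G_e$ denote vertex and edge stabilizers. A subgroup of $G$ is elliptic in $T$ if it fixes a point of $T$. A deformation space $\mathcal{D}$ is the set of all $G$-trees having the same elliptic subgroups as a given $G$-tree; these are called the elliptic subgroups of $\mathcal{D}$. $b_1(\mathcal{D})$ is the first Betti number of the (topological) quotient graph $T/G$ for any $T\in\mathcal{D}$; it depends only on $\mathcal{D}$, since it is the rank of the free group obtained as the quotient of $G$ by the subgroup generated by all elliptic elements (elements fixing a point). Vertical set $\mathcal{M}$: for elliptic subgroups $H,K$ of $\mathcal{D}$, write $H\le K$ if $H$ is contained in a conjugate of $K$, and $H\sim K$ if $H\le K$ and $K\le H$. The set of equivalence classes is partially ordered by $\le$, and $\mathcal{M}$ is the set of its maximal elements. $T$ is reduced if, whenever an edge $e=vw$ satisfies $G_e=G_v$, the vertices $v$ and $w$ are in the same $G$-orbit. $T$ is BF-reduced (reduced in the sense of Bestvina-Feighn) if, whenever an edge $e=vw$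 satisfies $G_e=G_v$, the image of $v$ in $T/G$ has valence at least 3.
   Formalization: In (2) the tree T is assumed to have at least one edge, since for T a single point (which is reduced) one has s = 1, |M| = 1, b_1 = 0 and the bound would read 1 ≤ 0. *)

theory Defs
  imports
    "HOL-Algebra.Group_Action"
    "HOL-Algebra.Generated_Groups"
    "HOL-Library.Poly_Mapping"
    Complex_Main
begin

definition finitely_generated :: "('g, 'b) monoid_scheme \<Rightarrow> bool" where
  "finitely_generated G \<longleftrightarrow>
     (\<exists>S. finite S \<and> S \<subseteq> carrier G \<and> generate G S = carrier G)"


section \<open>Simplicial trees\<close>

text \<open>A simplicial tree is given by its vertex set \<open>V\<close> and its set \<open>E\<close> of unoriented edges, an
  edge being the set of its two endpoints.\<close>

definition walk_in :: "'v set \<Rightarrow> 'v set set \<Rightarrow> 'v list \<Rightarrow> bool" where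
  "walk_in V E p \<longleftrightarrow> p \<noteq> [] \<and> set p \<subseteq> V \<and> successively (\<lambda>x y. {x, y} \<in> E) p"

definition cycle_in :: "'v set \<Rightarrow> 'v set set \<Rightarrow> 'v list \<Rightarrow> bool" where
  "cycle_in V E p \<longleftrightarrow> walk_in V E p \<and> distinct p \<and> length p \<ge> 3 \<and> {last p, hd p} \<in> E"

definition simplicial_tree :: "'v set \<Rightarrow> 'v set set \<Rightarrow> bool" where
  "simplicial_tree V E \<longleftrightarrow>
     V \<noteq> {} \<and>
     (\<forall>e\<in>E. e \<subseteq> V \<and> card e = 2) \<and>
     (\<forall>u\<in>V. \<forall>v\<in>V. \<exists>p. walk_in V E p \<and> hd p = u \<and> last p = v) \<and>
     (\<nexists>p. cycle_in V E p)"


section \<open>Trees with a group action\<close>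

text \<open>The metric is recorded by the edge lengths: an action by simplicial automorphisms is
  isometric iff it preserves them.\<close>

record ('g, 'v) gtree =
  vertices :: "'v set"
  edges :: "'v set set"
  edge_length :: "'v set \<Rightarrow> real"
  act :: "'g \<Rightarrow> 'v \<Rightarrow> 'v"

definition act_edge :: "('g, 'v) gtree \<Rightarrow> 'g \<Rightarrow> 'v set \<Rightarrow> 'v set" where
  "act_edge T g e = act T g ` e"

definition invariant_subtree ::
    "('g, 'b) monoid_scheme \<Rightarrow> ('g, 'v) gtree \<Rightarrow> 'v set \<Rightarrow> 'v set set \<Rightarrow> bool" where
  "invariant_subtree G T V E \<longleftrightarrow>
     V \<subseteq> vertices T \<and> E \<subseteq> edges T \<and> simplicial_tree V E \<and>
     (\<forall>g\<in>carrier G. act T g ` V = V \<and> act_edge T g ` E = E)"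

definition G_tree :: "('g, 'b) monoid_scheme \<Rightarrow> ('g, 'v) gtree \<Rightarrow> bool" where
  "G_tree G T \<longleftrightarrow>
     simplicial_tree (vertices T) (edges T) \<and>
     (\<forall>e\<in>edges T. edge_length T e > 0) \<and>
     group_action G (vertices T) (act T) \<and>
     (\<forall>g\<in>carrier G. \<forall>e\<in>edges T.
        act_edge T g e \<in> edges T \<and> edge_length T (act_edge T g e) = edge_length T e) \<and>
     \<comment> \<open>no inversions\<close>
     (\<forall>g\<in>carrier G. \<forall>v w. {v, w} \<in> edges T \<longrightarrow> \<not> (act T g v = w \<and> act T g w = v)) \<and>
     \<comment> \<open>minimality\<close>
     (\<forall>V E. invariant_subtree G T V E \<longrightarrow> V = vertices T \<and> E = edges T)"

text \<open>Points of the geometric realization, in barycentric coordinates: the support is a vertex or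
  the pair of endpoints of an edge. Since the action is affine on edges, \<open>h\<close> moves \<open>p\<close> to
  \<open>p \<circ> h\<^sup>-\<^sup>1\<close>, so \<open>h\<close> fixes \<open>p\<close> iff \<open>p \<circ> h = p\<close> on vertices.\<close>

definition points :: "('g, 'v) gtree \<Rightarrow> ('v \<Rightarrow> real) set" where
  "points T = {p. (\<forall>v. p v \<ge> 0) \<and>
     ({v. p v \<noteq> 0} \<in> edges T \<or> (\<exists>u\<in>vertices T. {v. p v \<noteq> 0} = {u})) \<and>
     (\<Sum>v | p v \<noteq> 0. p v) = 1}"

definition fixes_point :: "('g, 'v) gtree \<Rightarrow> 'g set \<Rightarrow> ('v \<Rightarrow> real) \<Rightarrow> bool" where
  "fixes_point T H p \<longleftrightarrow> (\<forall>h\<in>H. \<forall>v\<in>vertices T. p (act T h v) = p v)"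

definition elliptic_subgroups :: "('g, 'b) monoid_scheme \<Rightarrow> ('g, 'v) gtree \<Rightarrow> 'g set set" where
  "elliptic_subgroups G T = {H. subgroup H G \<and> (\<exists>p\<in>points T. fixes_point T H p)}"


section \<open>Quotient graphs\<close>

text \<open>Graphs in the sense of Serre (loops and multiple edges allowed): each unoriented edge is a
  pair of mutually reverse arcs.\<close>

record ('n, 'a) serre_graph =
  nodes :: "'n set"
  arcs :: "'a set"
  origin :: "'a \<Rightarrow> 'n"
  rev_arc :: "'a \<Rightarrow> 'a"

text \<open>A loop at \<open>x\<close> contributes 2 to the valence, both of its arcs having origin \<open>x\<close>.\<close>

definition valence :: "('n, 'a) serre_graph \<Rightarrow> 'n \<Rightarrow> nat" where
  "valence \<Gamma> x = card {a \<in> arcs \<Gamma>. origin \<Gamma> a = x}"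

text \<open>The first Betti number is the dimension of the first simplicial homology with real
  coefficients. A 1-chain is a finitely supported function on arcs, alternating under reversal;
  up to sign its boundary at a node \<open>x\<close> is the sum of its values on the arcs with origin \<open>x\<close>.
  As there are no 2-cells, the homology is the space of 1-cycles.\<close>

definition cycle_space :: "('n, 'a) serre_graph \<Rightarrow> ('a \<Rightarrow>\<^sub>0 real) set" where
  "cycle_space \<Gamma> = {c. Poly_Mapping.keys c \<subseteq> arcs \<Gamma> \<and>
     (\<forall>a\<in>arcs \<Gamma>. Poly_Mapping.lookup c (rev_arc \<Gamma> a) = - Poly_Mapping.lookup c a) \<and>
     (\<forall>x\<in>nodes \<Gamma>. (\<Sum>a \<in> {a \<in> Poly_Mapping.keys c. origin \<Gamma> a = x}. Poly_Mapping.lookup c a) = 0)}"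

definition chain_scale :: "real \<Rightarrow> ('a \<Rightarrow>\<^sub>0 real) \<Rightarrow> ('a \<Rightarrow>\<^sub>0 real)" where
  "chain_scale r c = Poly_Mapping.map (\<lambda>x. r * x) c"

lemma lookup_chain_scale: "Poly_Mapping.lookup (chain_scale r c) a = r * Poly_Mapping.lookup c a"
  by (simp add: chain_scale_def map.rep_eq when_def)

lemma vector_space_chain_scale: "vector_space chain_scale"
  by unfold_locales
    (auto intro!: poly_mapping_eqI simp: lookup_chain_scale Poly_Mapping.lookup_add algebra_simps)

definition first_betti :: "('n, 'a) serre_graph \<Rightarrow> nat" where
  "first_betti \<Gamma> = vector_space.dim chain_scale (cycle_space \<Gamma>)"

text \<open>An oriented edge of the tree is an ordered pair of adjacent vertices. An arc of the quotient
  is an orbit of such pairs, i.e. a relation on vertices: its origin (a vertex orbit) is the domain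
  of this relation, and its reverse is the converse relation.\<close>

definition oriented_edges :: "('g, 'v) gtree \<Rightarrow> ('v \<times> 'v) set" where
  "oriented_edges T = {(v, w). {v, w} \<in> edges T}"

definition quotient_graph ::
    "('g, 'b) monoid_scheme \<Rightarrow> ('g, 'v) gtree \<Rightarrow> ('v set, ('v \<times> 'v) set) serre_graph" where
  "quotient_graph G T =
     \<lparr> nodes = orbits G (vertices T) (act T),
       arcs = orbits G (oriented_edges T) (\<lambda>g. map_prod (act T g) (act T g)),
       origin = Domain,
       rev_arc = converse \<rparr>"


section \<open>Reduced trees\<close>

definition reduced :: "('g, 'b) monoid_scheme \<Rightarrow> ('g, 'v) gtree \<Rightarrow> bool" where
  "reduced G T \<longleftrightarrow>
     (\<forall>v w. {v, w} \<in> edges T \<and>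
        stabilizer G (act_edge T) {v, w} = stabilizer G (act T) v \<longrightarrow>
        orbit G (act T) v = orbit G (act T) w)"

definition BF_reduced :: "('g, 'b) monoid_scheme \<Rightarrow> ('g, 'v) gtree \<Rightarrow> bool" where
  "BF_reduced G T \<longleftrightarrow>
     (\<forall>v w. {v, w} \<in> edges T \<and>
        stabilizer G (act_edge T) {v, w} = stabilizer G (act T) v \<longrightarrow>
        valence (quotient_graph G T) (orbit G (act T) v) \<ge> 3)"


section \<open>Deformation spaces\<close>

text \<open>Trees are not identified up to equivariant isometry here; every notion below is invariant
  under equivariant simplicial isometry.\<close>

definition deformation_space ::
    "('g, 'b) monoid_scheme \<Rightarrow> ('g, 'v) gtree set \<Rightarrow> bool" where
  "deformation_space G D \<longleftrightarrow>
     (\<exists>T0 :: ('g, 'v) gtree. G_tree G T0 \<and>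
        D = {T. G_tree G T \<and> elliptic_subgroups G T = elliptic_subgroups G T0})"

definition elliptics :: "('g, 'b) monoid_scheme \<Rightarrow> ('g, 'v) gtree set \<Rightarrow> 'g set set" where
  "elliptics G D = (\<Union>T\<in>D. elliptic_subgroups G T)"

text \<open>Meaningful for a deformation space, on which the Betti number of the quotient graph is
  constant.\<close>

definition betti_number :: "('g, 'b) monoid_scheme \<Rightarrow> ('g, 'v) gtree set \<Rightarrow> nat" where
  "betti_number G D = (THE b. \<forall>T\<in>D. first_betti (quotient_graph G T) = b)"

definition conj_le :: "('g, 'b) monoid_scheme \<Rightarrow> 'g set \<Rightarrow> 'g set \<Rightarrow> bool" where
  "conj_le G H K \<longleftrightarrow> (\<exists>g\<in>carrier G. H \<subseteq> g <#\<^bsub>G\<^esub> K #>\<^bsub>G\<^esub> inv\<^bsub>G\<^esub> g)"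

definition elliptic_classes ::
    "('g, 'b) monoid_scheme \<Rightarrow> ('g, 'v) gtree set \<Rightarrow> 'g set set set" where
  "elliptic_classes G D =
     elliptics G D //
       {(H, K). H \<in> elliptics G D \<and> K \<in> elliptics G D \<and> conj_le G H K \<and> conj_le G K H}"

definition class_le :: "('g, 'b) monoid_scheme \<Rightarrow> 'g set set \<Rightarrow> 'g set set \<Rightarrow> bool" where
  "class_le G X Y \<longleftrightarrow> (\<exists>H\<in>X. \<exists>K\<in>Y. conj_le G H K)"

definition vertical_set ::
    "('g, 'b) monoid_scheme \<Rightarrow> ('g, 'v) gtree set \<Rightarrow> 'g set set set" where
  "vertical_set G D =
     {X \<in> elliptic_classes G D. \<forall>Y\<in>elliptic_classes G D. class_le G X Y \<longrightarrow> Y = X}"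

end

theory Submission
  imports Defs
begin

text \<open>Let \<open>\<Gamma> = T/G\<close> have \<open>s\<close> vertices and \<open>e\<close> edges, so that \<open>b\<^sub>1 \<ge> e - s + 1\<close>.
  Every elliptic subgroup fixes a vertex, so each element of \<open>\<M>\<close> is the class of a vertex
  stabilizer; this is (1), \<open>\<Gamma>\<close> being finite by minimality. If \<open>G\<^sub>v\<close> is properly larger than
  \<open>G\<^sub>e\<close> for every edge \<open>e\<close> at \<open>v\<close>, then \<open>v\<close> is the only point fixed by \<open>G\<^sub>v\<close>, so the class
  of \<open>G\<^sub>v\<close> is in \<open>\<M>\<close> and determines the orbit of \<open>v\<close>. When \<open>T\<close> is reduced or BF-reduced
  this injects the vertices of \<open>\<Gamma>\<close> of valence at most \<open>2\<close> into \<open>\<M>\<close>, and (2) follows by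
  summing valences: \<open>2e \<ge> 3s - 2|\<M>|\<close>.

  To see that \<open>b\<^sub>1\<close> depends only on the deformation space, map each vertex of \<open>T\<close>
  equivariantly to a vertex of \<open>T'\<close> and conversely; pushing cycles forward along tree paths gives
  mutually inverse maps (up to a scalar) between the cycle spaces of the two quotient graphs.\<close>

section \<open>Walks and cocycles in trees\<close>

lemma walk_in_join:
  "walk_in V E (p @ x # q) \<longleftrightarrow> walk_in V E (p @ [x]) \<and> walk_in V E (x # q)"
  by (auto simp: walk_in_def successively_append_iff)

lemma walk_in_rev: "walk_in V E (rev p) \<longleftrightarrow> walk_in V E p"
  by (simp add: walk_in_def insert_commute)

lemma walk_in_Cons2: "walk_in V E (x # y # p) \<longleftrightarrow> x \<in> V \<and> {x, y} \<in> E \<and> walk_in V E (y # p)"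
  by (auto simp: walk_in_def)

text \<open>The values lie in an arbitrary abelian group because there are two uses: integers, to
  count passages through an edge, and chains, to project paths to the quotient graph.\<close>

fun walk_sum :: "('v \<Rightarrow> 'v \<Rightarrow> 'c::ab_group_add) \<Rightarrow> 'v list \<Rightarrow> 'c" where
  "walk_sum f (x # y # p) = f x y + walk_sum f (y # p)"
| "walk_sum f _ = 0"

lemma walk_sum_join: "walk_sum f (p @ x # q) = walk_sum f (p @ [x]) + walk_sum f (x # q)"
proof (induction p)
  case (Cons a p)
  then show ?case by (cases p) (auto simp: algebra_simps)
qed simp

lemma walk_sum_rev:
  assumes "\<And>x y. f y x = - f x y"
  shows "walk_sum f (rev p) = - walk_sum f p"
proof (induction p)
  case (Cons a p)
  show ?case
  proof (cases p)
    case (Cons b q)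
    then have "walk_sum f (rev (a # p)) = walk_sum f (rev p) + f b a"
      using walk_sum_join[of f "rev q" b "[a]"] by simp
    then show ?thesis using Cons Cons.IH assms[of b a] by simp
  qed simp
qed simp

text \<open>A closed walk that meets a vertex twice, apart from its closing point, splits there into
  two shorter closed walks. Without such a repetition it would be a cycle, unless it is a single
  vertex or runs once back and forth along an edge, where antisymmetry cancels the two
  terms.\<close>

lemma closed_walk_sum:
  assumes tree: "simplicial_tree V E" and anti: "\<And>x y. f y x = - f x y"
    and "walk_in V E p" "hd p = last p"
  shows "walk_sum f p = 0"
  using assms(3,4)
proof (induction "length p" arbitrary: p rule: less_induct)
  case less
  from less.prems(1) obtain x q where p: "p = x # q" by (cases p) (auto simp: walk_in_def)
  show ?case
  proof (cases q rule: rev_cases)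
    case Nil
    then show ?thesis using p by simp
  next
    case (snoc r y)
    with less.prems p have p: "p = x # r @ [x]" by simp
    show ?thesis
    proof (cases "distinct (x # r)")
      case True
      consider "r = []" | z where "r = [z]" | "length (x # r) \<ge> 3"
        by (cases r; cases "tl r") auto
      then show ?thesis
      proof cases
        case 1
        then have "{x, x} \<in> E" using less.prems(1) p by (simp add: walk_in_def)
        then have "card {x, x} = 2" using tree unfolding simplicial_tree_def by blast
        then show ?thesis by simp
      next
        case 2
        then show ?thesis using p anti[of z x] by simp
      next
        case 3
        have "walk_in V E (x # r)"
          using less.prems(1) 3 p by (cases r; cases "tl r") (auto simp: walk_in_def successively_append_iff successively_Cons)
        moreover have "{last (x # r), hd (x # r)} \<in> E"
          using less.prems(1) p
          unfolding walk_in_def by (auto simp: successively_append_iff successively_Cons)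
        ultimately have "cycle_in V E (x # r)"
          unfolding cycle_in_def using True 3 by blast
        then show ?thesis using tree by (auto simp: simplicial_tree_def)
      qed
    next
      case False
      then obtain a y b c where d: "x # r = a @ [y] @ b @ [y] @ c"
        using not_distinct_decomp by blast
      then have p': "p = a @ y # b @ y # c @ [x]" using p by simp
      have w: "walk_in V E (a @ [y])" "walk_in V E (y # b @ [y])" "walk_in V E (y # c @ [x])"
        using less.prems(1) walk_in_join[of V E a y "b @ y # c @ [x]"]
          walk_in_join[of V E "y # b" y "c @ [x]"] by (simp_all add: p')
      then have "walk_in V E (a @ y # c @ [x])" using walk_in_join[of V E a y] by blast
      moreover have "hd (a @ y # c @ [x]) = x" using d by (cases a) auto
      ultimately have "walk_sum f (a @ y # c @ [x]) = 0"
        by (intro less.hyps) (auto simp: p')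
      moreover have "walk_sum f (y # b @ [y]) = 0"
        using w by (intro less.hyps) (auto simp: p')
      ultimately show ?thesis
        using walk_sum_join[of f a y "b @ y # c @ [x]"] walk_sum_join[of f "y # b" y "c @ [x]"]
          walk_sum_join[of f a y "c @ [x]"] by (simp add: p')
    qed
  qed
qed

text \<open>One walk followed by the reverse of the other is closed, so the two sums differ by
  zero.\<close>

lemma walk_sum_endpoints:
  assumes tree: "simplicial_tree V E" and anti: "\<And>x y. f y x = - f x y"
    and p: "walk_in V E p" and q: "walk_in V E q" and ends: "hd p = hd q" "last p = last q"
  shows "walk_sum f p = walk_sum f q"
proof -
  obtain p' z where p': "p = p' @ [z]" using p by (cases p rule: rev_cases) (auto simp: walk_in_def)
  obtain q' where q': "q = q' @ [z]"
    using q ends p' by (cases q rule: rev_cases) (auto simp: walk_in_def)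
  have rq: "rev q = z # rev q'" using q' by simp
  have "walk_in V E (p' @ z # rev q')"
    using p q p' rq walk_in_join walk_in_rev by metis
  moreover have "hd (p' @ z # rev q') = last (p' @ z # rev q')"
    using ends p' q' by (cases p'; cases q') auto
  ultimately have "walk_sum f (p' @ z # rev q') = 0"
    using closed_walk_sum[OF tree, of f] anti by blast
  then have "walk_sum f p + walk_sum f (rev q) = 0"
    using walk_sum_join[of f p' z "rev q'"] p' rq by simp
  then show ?thesis using walk_sum_rev[of f q, OF anti] by simp
qed

section \<open>Functions of vertex pairs determined by their values on edges\<close>

definition cocycle_on :: "'v set \<Rightarrow> ('v \<Rightarrow> 'v \<Rightarrow> 'c::ab_group_add) \<Rightarrow> bool" where
  "cocycle_on V J \<longleftrightarrow> (\<forall>x\<in>V. \<forall>y\<in>V. \<forall>z\<in>V. J x z = J x y + J y z)"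

lemma cocycle_onD: "cocycle_on V J \<Longrightarrow> x \<in> V \<Longrightarrow> y \<in> V \<Longrightarrow> z \<in> V \<Longrightarrow> J x z = J x y + J y z"
  unfolding cocycle_on_def by blast

lemma cocycle_on_refl: "cocycle_on V J \<Longrightarrow> x \<in> V \<Longrightarrow> J x x = 0"
  using cocycle_onD[of V J x x x] by (metis add_cancel_left_left)

lemma cocycle_on_swap: "cocycle_on V J \<Longrightarrow> x \<in> V \<Longrightarrow> y \<in> V \<Longrightarrow> J y x = - J x y"
  using cocycle_onD[of V J x y x] cocycle_on_refl[of V J x] by (metis minus_unique)

lemma walk_between:
  assumes "simplicial_tree V E" "x \<in> V" "y \<in> V"
  obtains p where "walk_in V E p" "hd p = x" "last p = y"
  using assms unfolding simplicial_tree_def by blast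

lemma tree_edgeD:
  assumes "simplicial_tree V E" "{x, y} \<in> E"
  shows "x \<in> V" "y \<in> V" "x \<noteq> y"
proof -
  have "{x, y} \<subseteq> V" "card {x, y} = 2" using assms unfolding simplicial_tree_def by blast+
  then show "x \<in> V" "y \<in> V" "x \<noteq> y" by auto
qed

text \<open>Sums along walks do not depend on the walk chosen, and concatenation of walks gives
  additivity. Together with \<open>cocycle_unique\<close> this identifies the cocycles on a tree
  with the antisymmetric functions on its oriented edges.\<close>

lemma tree_cocycle_exists:
  assumes tree: "simplicial_tree V E" and anti: "\<And>x y. f y x = - f x y"
  shows "\<exists>J. cocycle_on V J \<and> (\<forall>x y. {x, y} \<in> E \<longrightarrow> J x y = f x y)"
proof -
  define J where "J x y = walk_sum f (SOME p. walk_in V E p \<and> hd p = x \<and> last p = y)" for x y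
  have J: "J x y = walk_sum f p" if p: "walk_in V E p" "hd p = x" "last p = y" for p x y
  proof -
    let ?q = "SOME p. walk_in V E p \<and> hd p = x \<and> last p = y"
    have "walk_in V E ?q \<and> hd ?q = x \<and> last ?q = y" by (rule someI[where x = p]) (simp add: p)
    then show ?thesis
      unfolding J_def using walk_sum_endpoints[OF tree, of f ?q p] anti p by metis
  qed
  have "J x z = J x y + J y z" if V: "x \<in> V" "y \<in> V" "z \<in> V" for x y z
  proof -
    obtain p where p: "walk_in V E p" "hd p = x" "last p = y" using walk_between tree V by metis
    obtain q where q: "walk_in V E q" "hd q = y" "last q = z" using walk_between tree V by metis
    obtain p' where p': "p = p' @ [y]" using p by (cases p rule: rev_cases) (auto simp: walk_in_def)
    obtain q' where q': "q = y # q'" using q by (cases q) (auto simp: walk_in_def)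
    have "walk_in V E (p' @ y # q')" using p q p' q' walk_in_join by metis
    moreover have "hd (p' @ y # q') = x" using p p' by (cases p') auto
    moreover have "last (p' @ y # q') = z" using q q' by simp
    ultimately have "J x z = walk_sum f (p' @ y # q')" using J by blast
    then show ?thesis using walk_sum_join[of f p' y q'] J[OF p] J[OF q] p' q' by simp
  qed
  moreover have "J x y = f x y" if "{x, y} \<in> E" for x y
    using J[of "[x, y]" x y] that tree_edgeD[OF tree that] by (simp add: walk_in_def)
  ultimately show ?thesis unfolding cocycle_on_def by blast
qed

lemma tree_induct [consumes 3, case_names base step]:
  assumes tree: "simplicial_tree V E" and "x \<in> V" "y \<in> V"
    and base: "P x" and step: "\<And>u w. u \<in> V \<Longrightarrow> P u \<Longrightarrow> {u, w} \<in> E \<Longrightarrow> P w"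
  shows "P y"
proof -
  obtain p where "walk_in V E p" "hd p = x" "last p = y" using walk_between assms by metis
  then show ?thesis using base
  proof (induction p arbitrary: x)
    case (Cons a p)
    show ?case
    proof (cases p)
      case (Cons b q)
      with Cons.prems have ab: "a \<in> V" "{a, b} \<in> E" "walk_in V E p" "P a"
        by (auto simp: walk_in_Cons2)
      then have "P b" using step by blast
      then show ?thesis using Cons.IH[of b] Cons.prems Cons ab by simp
    qed (use Cons.prems in auto)
  qed (simp add: walk_in_def)
qed

text \<open>Adding one edge at a time along a walk from \<open>x\<close> keeps both sides equal.
  Identities between path quantities are proved in this way below: both sides are cocycles, so only
  edges have to be compared.\<close>

lemma cocycle_unique:
  assumes tree: "simplicial_tree V E" and J: "cocycle_on V J" and K: "cocycle_on V K"
    and E: "\<And>x y. {x, y} \<in> E \<Longrightarrow> J x y = K x y" and xy: "x \<in> V" "y \<in> V"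
  shows "J x y = K x y"
  using tree xy
proof (induction rule: tree_induct)
  case base
  show ?case using cocycle_on_refl J K xy by metis
next
  case (step u w)
  then show ?case
    using cocycle_onD[OF J xy(1), of u w] cocycle_onD[OF K xy(1), of u w] E tree_edgeD[OF tree] by metis
qed

text \<open>A form of uniqueness of geodesics for walks that may backtrack after the first step, as
  long as they never return to \<open>v\<close>. The net number of passages through
  \<open>(v, a)\<close> is then decided by the first step, while it depends only on the endpoints of
  the walk.\<close>

lemma tree_first_step_unique:
  assumes tree: "simplicial_tree V E"
    and p: "walk_in V E (v # a # p)" "v \<notin> set (a # p)"
    and q: "walk_in V E (v # b # q)" "v \<notin> set (b # q)"
    and last: "last (a # p) = last (b # q)"
  shows "a = b"
proof -
  \<comment> \<open>the signed number of passages through the oriented edge \<open>(v, a)\<close>\<close>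
  define f :: "_ \<Rightarrow> _ \<Rightarrow> int" where
    "f x y = of_bool (x = v \<and> y = a) - of_bool (x = a \<and> y = v)" for x y
  have avoid: "walk_sum f r = 0" if "v \<notin> set r" for r
    using that
  proof (induction r)
    case (Cons x r)
    then show ?case by (cases r) (auto simp: f_def)
  qed simp
  have "walk_sum f (v # a # p) = walk_sum f (v # b # q)"
  proof (rule walk_sum_endpoints[OF tree _ p(1) q(1)])
    show "f y x = - f x y" for x y
      unfolding f_def by (cases "x = v"; cases "y = v"; cases "x = a"; cases "y = a") simp_all
    show "last (v # a # p) = last (v # b # q)" using last by (metis last_ConsR list.distinct(1))
  qed simp
  then have "f v a = f v b" using avoid[OF p(2)] avoid[OF q(2)] by simp
  moreover have "v \<noteq> a" using p(2) by auto
  ultimately show ?thesis by (cases "b = a") (simp_all add: f_def)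
qed

text \<open>\<open>a\<close> is the vertex reached after the last visit to \<open>v\<close> on a
  walk to \<open>w\<close>. A map fixing \<open>v\<close> and \<open>w\<close> carries the rest of
  this walk to another walk that avoids \<open>v\<close>, so both have the same first step. As
  \<open>a\<close> is chosen before the map, one edge serves for a whole group of maps.\<close>

lemma tree_fixed_edge:
  assumes tree: "simplicial_tree V E" and "v \<in> V" "w \<in> V" "v \<noteq> w"
  obtains a where "{v, a} \<in> E"
    "\<And>\<phi>. inj_on \<phi> V \<Longrightarrow> \<phi> ` V \<subseteq> V \<Longrightarrow> (\<And>x y. {x, y} \<in> E \<Longrightarrow> {\<phi> x, \<phi> y} \<in> E) \<Longrightarrow>
       \<phi> v = v \<Longrightarrow> \<phi> w = w \<Longrightarrow> \<phi> a = a"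
proof -
  obtain p where p: "walk_in V E p" "hd p = v" "last p = w" using walk_between assms by metis
  then have "v \<in> set p" by (auto simp: walk_in_def)
  then obtain ys zs where zs: "p = ys @ v # zs" "v \<notin> set zs" by (meson split_list_last)
  then obtain a r where r: "zs = a # r" using p assms(4) by (cases zs) auto
  have wr: "walk_in V E (v # a # r)" using p zs r walk_in_join by metis
  have lr: "last (a # r) = w" using p zs r by simp
  show ?thesis
  proof
    show "{v, a} \<in> E" using wr by (simp add: walk_in_def)
    fix \<phi> assume \<phi>: "inj_on \<phi> V" "\<phi> ` V \<subseteq> V" "\<And>x y. {x, y} \<in> E \<Longrightarrow> {\<phi> x, \<phi> y} \<in> E"
      "\<phi> v = v" "\<phi> w = w"
    have sub: "set (a # r) \<subseteq> V" using wr by (auto simp: walk_in_def)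
    have "walk_in V E (map \<phi> (v # a # r))"
      unfolding walk_in_def successively_map
    proof (intro conjI)
      show "set (map \<phi> (v # a # r)) \<subseteq> V" using sub \<phi>(2) assms(2) by auto
      show "successively (\<lambda>x y. {\<phi> x, \<phi> y} \<in> E) (v # a # r)"
        using wr \<phi>(3) unfolding walk_in_def by (blast intro: successively_mono)
    qed simp
    moreover have "v \<notin> \<phi> ` set (a # r)"
    proof
      assume "v \<in> \<phi> ` set (a # r)"
      then obtain y where "y \<in> set (a # r)" "\<phi> y = \<phi> v" using \<phi>(4) by auto
      then show False using \<phi>(1) sub assms(2) zs(2) r by (metis inj_onD subsetD)
    qed
    moreover have "last (map \<phi> (a # r)) = w" using lr \<phi>(5) last_map[of "a # r" \<phi>] by simp
    ultimately show "\<phi> a = a"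
      using tree_first_step_unique[OF tree wr, of "\<phi> a" "map \<phi> r"] zs(2) r lr \<phi>(4) by auto
  qed
qed

lemma tree_neighbour:
  assumes tree: "simplicial_tree V E" and "E \<noteq> {}" "v \<in> V"
  obtains w where "{v, w} \<in> E"
proof -
  obtain e where e: "e \<in> E" using assms(2) by blast
  then have "card e = 2" "e \<subseteq> V" using tree unfolding simplicial_tree_def by blast+
  then obtain x y where "e = {x, y}" "x \<noteq> y" "x \<in> V" "y \<in> V"
    by (metis card_2_iff insert_subset)
  then obtain w where "w \<in> V" "v \<noteq> w" by metis
  then show ?thesis using tree_fixed_edge[OF tree assms(3), of w] that by metis
qed

section \<open>Dimension counts\<close>

context vector_space
begin

text \<open>The space of all chains may be infinite-dimensional, so finite dimension is expressed by
  a finite set \<open>B\<close> whose span contains \<open>S\<close>. It forces the basis that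
  computes \<open>dim S\<close> to be finite, and the exchange bound applies.\<close>

lemma independent_card_le_dim_of_span:
  assumes "finite B" "S \<subseteq> span B" "C \<subseteq> S" "independent C"
  shows "card C \<le> dim S"
proof -
  obtain B' where B': "B' \<subseteq> S" "independent B'" "S \<subseteq> span B'" "card B' = dim S"
    using basis_exists by blast
  then have "finite B'" using independent_span_bound[OF assms(1)] assms(2) by blast
  then show ?thesis using independent_span_bound[of B' C] B' assms(3,4) by auto
qed

text \<open>If \<open>\<phi> u \<noteq> 0\<close>, subtracting a multiple of \<open>u\<close> moves
  any vector of \<open>S\<close> into the kernel, so a basis of the kernel together with
  \<open>u\<close> spans \<open>S\<close>.\<close>

lemma dim_le_dim_kernel:
  assumes B: "finite B" "S \<subseteq> span B" and S: "subspace S"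
    and add: "\<And>x y. \<phi> (x + y) = \<phi> x + \<phi> y" and scale: "\<And>r x. \<phi> (scale r x) = r * \<phi> x"
  shows "dim S \<le> dim {x \<in> S. \<phi> x = 0} + 1"
proof (cases "\<forall>x\<in>S. \<phi> x = 0")
  case True
  then have "{x \<in> S. \<phi> x = 0} = S" by blast
  then show ?thesis by simp
next
  case False
  then obtain u where u: "u \<in> S" "\<phi> u \<noteq> 0" by blast
  obtain C where C: "C \<subseteq> {x \<in> S. \<phi> x = 0}" "independent C" "{x \<in> S. \<phi> x = 0} \<subseteq> span C"
    "card C = dim {x \<in> S. \<phi> x = 0}" using basis_exists by blast
  have "C \<subseteq> span B" using C(1) B(2) by blast
  then have finC: "finite C" using independent_span_bound[OF B(1) C(2)] by blast
  have "x \<in> span (insert u C)" if x: "x \<in> S" for x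
  proof -
    let ?y = "x - scale (\<phi> x / \<phi> u) u"
    have "\<phi> x = \<phi> ?y + \<phi> (scale (\<phi> x / \<phi> u) u)" unfolding add[symmetric] by simp
    then have "\<phi> ?y = 0" using u by (simp add: scale)
    moreover have "?y \<in> S" using S x u by (intro subspace_diff subspace_scale)
    ultimately have "?y \<in> span C" using C(3) by blast
    then show ?thesis by (auto simp: span_breakdown_eq)
  qed
  then have "dim S \<le> card (insert u C)" using finC by (intro dim_le_card) auto
  also have "\<dots> \<le> card C + 1" using finC by (simp add: card_insert_if)
  finally show ?thesis using C(4) by simp
qed

lemma dim_le_dim_kernels:
  assumes B: "finite B" "S \<subseteq> span B" and S: "subspace S" and "finite I"
    and add: "\<And>i x y. \<phi> i (x + y) = \<phi> i x + \<phi> i y"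
    and scale: "\<And>i r x. \<phi> i (scale r x) = r * \<phi> i x"
  shows "dim S \<le> dim {x \<in> S. \<forall>i\<in>I. \<phi> i x = 0} + card I"
  using \<open>finite I\<close>
proof (induction I)
  case (insert i I)
  let ?K = "{x \<in> S. \<forall>i\<in>I. \<phi> i x = 0}"
  have zero: "\<phi> i 0 = 0" for i using scale[of i 0 0] by simp
  have "subspace ?K"
    using S unfolding subspace_def by (auto simp: add scale zero)
  then have "dim ?K \<le> dim {x \<in> ?K. \<phi> i x = 0} + 1"
    using B(2) by (intro dim_le_dim_kernel[OF B(1)]) (auto simp: add scale)
  moreover have "{x \<in> ?K. \<phi> i x = 0} = {x \<in> S. \<forall>j\<in>insert i I. \<phi> j x = 0}" by auto
  ultimately show ?case using insert by simp
qed simp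

end

context vector_space_pair
begin

lemma dim_le_of_linear_inj_on:
  assumes lin: "Vector_Spaces.linear s1 s2 f" and S: "vs1.subspace S" and inj: "inj_on f S"
    and im: "f ` S \<subseteq> S'" and B: "finite B" "S' \<subseteq> vs2.span B"
  shows "vs1.dim S \<le> vs2.dim S'"
proof -
  obtain C where C: "C \<subseteq> S" "vs1.independent C" "S \<subseteq> vs1.span C" "card C = vs1.dim S"
    using vs1.basis_exists by blast
  have "vs1.span C = S" using C S vs1.span_subspace by blast
  then have "vs2.independent (f ` C)"
    using linear_independent_injective_image[OF lin C(2)] inj by simp
  then have "card (f ` C) \<le> vs2.dim S'"
    using C(1) im by (intro vs2.independent_card_le_dim_of_span[OF B]) auto
  moreover have "card (f ` C) = card C" using inj_on_subset[OF inj C(1)] by (rule card_image)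
  ultimately show ?thesis using C(4) by simp
qed

end

section \<open>Chains of a graph and the Euler characteristic estimate\<close>

global_interpretation chain: vector_space "chain_scale :: real \<Rightarrow> ('a \<Rightarrow>\<^sub>0 real) \<Rightarrow> ('a \<Rightarrow>\<^sub>0 real)"
  by (rule vector_space_chain_scale)

global_interpretation chain_pair: vector_space_pair
  "chain_scale :: real \<Rightarrow> ('a \<Rightarrow>\<^sub>0 real) \<Rightarrow> ('a \<Rightarrow>\<^sub>0 real)"
  "chain_scale :: real \<Rightarrow> ('b \<Rightarrow>\<^sub>0 real) \<Rightarrow> ('b \<Rightarrow>\<^sub>0 real)" ..

lemma chain_in_span_singles:
  assumes "finite A" "Poly_Mapping.keys c \<subseteq> A"
  shows "c \<in> chain.span ((\<lambda>a. Poly_Mapping.single a 1) ` A)"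
proof -
  have "c = (\<Sum>a\<in>A. chain_scale (Poly_Mapping.lookup c a) (Poly_Mapping.single a 1))"
    (is "_ = ?s")
  proof (rule poly_mapping_eqI)
    fix b
    have "Poly_Mapping.lookup ?s b = (\<Sum>a\<in>A. if a = b then Poly_Mapping.lookup c b else 0)"
      by (auto simp: lookup_sum lookup_chain_scale lookup_single when_def intro!: sum.cong)
    also have "\<dots> = Poly_Mapping.lookup c b"
      using assms by (auto simp: in_keys_iff)
    finally show "Poly_Mapping.lookup c b = Poly_Mapping.lookup ?s b" by simp
  qed
  then show ?thesis
    by (metis (no_types, lifting) chain.span_base chain.span_scale chain.span_sum imageI)
qed

text \<open>A fixed-point-free involution has orbits of two elements, and \<open>P\<close> takes one
  from each. For the reversal of arcs this is an orientation of the graph.\<close>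

lemma involution_orientation:
  assumes "finite A" "\<And>a. a \<in> A \<Longrightarrow> r a \<in> A \<and> r a \<noteq> a \<and> r (r a) = a"
  obtains P where "P \<subseteq> A" "\<And>a. a \<in> P \<Longrightarrow> r a \<notin> P" "card A = 2 * card P"
proof
  \<comment> \<open>The choice depends only on the set \<open>{a, r a}\<close>, so \<open>a\<close>
    and \<open>r a\<close> make the same choice.\<close>
  define pick where "pick a = (SOME b. b \<in> {a, r a})" for a
  have pick: "pick a \<in> {a, r a}" for a unfolding pick_def by (rule someI[of _ a]) simp
  have pick_r: "pick (r a) = pick a" if "a \<in> A" for a
    using assms(2)[OF that] by (simp add: pick_def insert_commute)
  let ?P = "{a \<in> A. pick a = a}"
  show "?P \<subseteq> A" by blast
  show disj: "r a \<notin> ?P" if "a \<in> ?P" for a using that pick_r assms(2)[of a] by auto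
  have "A = ?P \<union> r ` ?P"
  proof
    show "A \<subseteq> ?P \<union> r ` ?P"
    proof
      fix a assume a: "a \<in> A"
      show "a \<in> ?P \<union> r ` ?P"
      proof (cases "pick a = a")
        case False
        then have "r a \<in> ?P" using pick[of a] pick_r[OF a] assms(2)[OF a] by auto
        then have "r (r a) \<in> r ` ?P" by (rule imageI)
        then show ?thesis using assms(2)[OF a] by (metis UnI2)
      qed (use a in auto)
    qed
  qed (use assms in auto)
  moreover have "?P \<inter> r ` ?P = {}" using disj by blast
  moreover have "inj_on r ?P" by (rule inj_on_inverseI[of _ r]) (use assms in auto)
  ultimately have "card A = card ?P + card ?P"
    using assms(1) by (metis (no_types, lifting) card_Un_disjoint card_image finite_Un)
  then show "card A = 2 * card ?P" by simp
qed

text \<open>The sum runs over all arcs at \<open>x\<close>, not over the support of \<open>c\<close>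
  as in \<open>cycle_space\<close>, so that linearity in \<open>c\<close> is immediate.\<close>

definition chain_boundary :: "('n, 'a) serre_graph \<Rightarrow> 'n \<Rightarrow> ('a \<Rightarrow>\<^sub>0 real) \<Rightarrow> real" where
  "chain_boundary \<Gamma> x c = (\<Sum>a \<in> {a \<in> arcs \<Gamma>. origin \<Gamma> a = x}. Poly_Mapping.lookup c a)"

lemma chain_boundary_add: "chain_boundary \<Gamma> x (c + d) = chain_boundary \<Gamma> x c + chain_boundary \<Gamma> x d"
  by (simp add: chain_boundary_def lookup_add sum.distrib)

lemma chain_boundary_scale: "chain_boundary \<Gamma> x (chain_scale r c) = r * chain_boundary \<Gamma> x c"
  by (simp add: chain_boundary_def lookup_chain_scale sum_distrib_left)

definition alternating_chains :: "('n, 'a) serre_graph \<Rightarrow> ('a \<Rightarrow>\<^sub>0 real) set" where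
  "alternating_chains \<Gamma> = {c. Poly_Mapping.keys c \<subseteq> arcs \<Gamma> \<and>
     (\<forall>a\<in>arcs \<Gamma>. Poly_Mapping.lookup c (rev_arc \<Gamma> a) = - Poly_Mapping.lookup c a)}"

lemma subspace_alternating_chains: "chain.subspace (alternating_chains \<Gamma>)"
  unfolding chain.subspace_def alternating_chains_def
  by (auto simp: lookup_add lookup_chain_scale in_keys_iff subset_iff) (metis add_0)

lemma cycle_space_eq:
  assumes "finite (arcs \<Gamma>)"
  shows "cycle_space \<Gamma> = {c \<in> alternating_chains \<Gamma>. \<forall>x\<in>nodes \<Gamma>. chain_boundary \<Gamma> x c = 0}"
proof -
  have "(\<Sum>a \<in> {a \<in> Poly_Mapping.keys c. origin \<Gamma> a = x}. Poly_Mapping.lookup c a) = chain_boundary \<Gamma> x c"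
    if "Poly_Mapping.keys c \<subseteq> arcs \<Gamma>" for x c
    unfolding chain_boundary_def using that assms
    by (intro sum.mono_neutral_left) (auto simp: in_keys_iff)
  then show ?thesis unfolding cycle_space_def alternating_chains_def by auto
qed

lemma sum_over_origins:
  assumes "finite (nodes \<Gamma>)" "finite (arcs \<Gamma>)" "\<And>a. a \<in> arcs \<Gamma> \<Longrightarrow> origin \<Gamma> a \<in> nodes \<Gamma>"
  shows "(\<Sum>x\<in>nodes \<Gamma>. \<Sum>a\<in>{a \<in> arcs \<Gamma>. origin \<Gamma> a = x}. f a) = sum f (arcs \<Gamma>)"
  using assms by (intro sum.group) auto

text \<open>With \<open>e\<close> edges and \<open>s\<close> nodes, an orientation gives
  \<open>e\<close> independent alternating chains, and \<open>s - 1\<close> boundary equations cut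
  out the cycles; hence the Betti number is at least \<open>e - s + 1\<close>. The inequality is
  doubled because every edge is counted as two arcs, and arranged without subtraction because it is
  about natural numbers.\<close>

lemma first_betti_lower_bound:
  assumes fin: "finite (nodes \<Gamma>)" "nodes \<Gamma> \<noteq> {}" "finite (arcs \<Gamma>)"
    and origin: "\<And>a. a \<in> arcs \<Gamma> \<Longrightarrow> origin \<Gamma> a \<in> nodes \<Gamma>"
    and rev: "\<And>a. a \<in> arcs \<Gamma> \<Longrightarrow>
      rev_arc \<Gamma> a \<in> arcs \<Gamma> \<and> rev_arc \<Gamma> a \<noteq> a \<and> rev_arc \<Gamma> (rev_arc \<Gamma> a) = a"
  shows "card (arcs \<Gamma>) + 2 \<le> 2 * first_betti \<Gamma> + 2 * card (nodes \<Gamma>)"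
proof -
  let ?A = "arcs \<Gamma>" and ?r = "rev_arc \<Gamma>"
  obtain P where P: "P \<subseteq> ?A" "\<And>a. a \<in> P \<Longrightarrow> ?r a \<notin> P" "card ?A = 2 * card P"
    using involution_orientation[OF fin(3), of ?r] rev by blast
  define e :: "_ \<Rightarrow> _ \<Rightarrow>\<^sub>0 real" where
    "e a = Poly_Mapping.single a 1 - Poly_Mapping.single (?r a) 1" for a
  have e_lookup: "Poly_Mapping.lookup (e a) b = of_bool (b = a) - of_bool (b = ?r a)" for a b
    by (simp add: e_def lookup_minus lookup_single when_def eq_commute)
  have span: "alternating_chains \<Gamma> \<subseteq> chain.span ((\<lambda>a. Poly_Mapping.single a 1) ` ?A)"
    using chain_in_span_singles[OF fin(3)] unfolding alternating_chains_def by blast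
  have e_diag: "Poly_Mapping.lookup (e a) a = 1" if "a \<in> P" for a
    using that P(1) rev[of a] by (auto simp: e_lookup)
  have e_off: "Poly_Mapping.lookup (e b) a = 0" if "a \<in> P" "b \<in> P" "a \<noteq> b" for a b
    using that P(2)[of b] by (auto simp: e_lookup)
  have "e ` P \<subseteq> alternating_chains \<Gamma>"
  proof
    fix c assume "c \<in> e ` P"
    then obtain a where a: "a \<in> ?A" "c = e a" using P(1) by blast
    have "(?r b = a) = (b = ?r a)" "(?r b = ?r a) = (b = a)" if "b \<in> ?A" for b
      using rev a(1) that by metis+
    then have "\<forall>b\<in>?A. Poly_Mapping.lookup c (?r b) = - Poly_Mapping.lookup c b"
      by (simp add: a(2) e_lookup)
    moreover have "Poly_Mapping.keys c \<subseteq> {a, ?r a}"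
      by (auto simp: a(2) in_keys_iff e_lookup)
    then have "Poly_Mapping.keys c \<subseteq> ?A" using a(1) rev by blast
    ultimately show "c \<in> alternating_chains \<Gamma>" by (simp add: alternating_chains_def)
  qed
  moreover have "chain.independent (e ` P)"
    unfolding chain.dependent_def
  proof safe
    fix a assume a: "a \<in> P" "e a \<in> chain.span (e ` P - {e a})"
    \<comment> \<open>The coefficient at \<open>a\<close> is 1 on \<open>e a\<close> and 0 on every
      other \<open>e b\<close>, so \<open>e a\<close> cannot lie in the span of the others.\<close>
    have "chain.subspace {c. Poly_Mapping.lookup c a = 0}"
      unfolding chain.subspace_def by (auto simp: lookup_add lookup_chain_scale)
    moreover have "e ` P - {e a} \<subseteq> {c. Poly_Mapping.lookup c a = 0}" using e_off a(1) by auto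
    ultimately have "chain.span (e ` P - {e a}) \<subseteq> {c. Poly_Mapping.lookup c a = 0}"
      by (intro chain.span_minimal)
    then show False using a e_diag by auto
  qed
  ultimately have "card (e ` P) \<le> chain.dim (alternating_chains \<Gamma>)"
    using fin(3) by (intro chain.independent_card_le_dim_of_span[OF _ span]) auto
  moreover have "inj_on e P" using e_diag e_off by (metis inj_onI zero_neq_one)
  ultimately have cardP: "card P \<le> chain.dim (alternating_chains \<Gamma>)" by (simp add: card_image)
  obtain z where z: "z \<in> nodes \<Gamma>" using fin(2) by blast
  \<comment> \<open>The boundaries of an alternating chain add up to \<open>0\<close>, so one node can be left out.\<close>
  have "chain_boundary \<Gamma> z c = 0"
    if c: "c \<in> alternating_chains \<Gamma>" "\<forall>x\<in>nodes \<Gamma> - {z}. chain_boundary \<Gamma> x c = 0" for c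
  proof -
    have "(\<Sum>a\<in>?A. Poly_Mapping.lookup c a) = (\<Sum>a\<in>?A. Poly_Mapping.lookup c (?r a))"
      using rev by (intro sum.reindex_bij_witness[of _ ?r ?r]) auto
    also have "\<dots> = - (\<Sum>a\<in>?A. Poly_Mapping.lookup c a)"
      using c(1) by (simp add: alternating_chains_def sum_negf)
    finally have "sum (Poly_Mapping.lookup c) ?A = 0" by simp
    then have "(\<Sum>x\<in>nodes \<Gamma>. chain_boundary \<Gamma> x c) = 0"
      unfolding chain_boundary_def by (simp only: sum_over_origins[OF fin(1,3) origin])
    then show ?thesis using c(2) z fin(1) by (simp add: sum.remove[of _ z])
  qed
  then have "cycle_space \<Gamma> =
      {c \<in> alternating_chains \<Gamma>. \<forall>x\<in>nodes \<Gamma> - {z}. chain_boundary \<Gamma> x c = 0}"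
    unfolding cycle_space_eq[OF fin(3)] by auto
  moreover have "chain.dim (alternating_chains \<Gamma>)
      \<le> chain.dim {c \<in> alternating_chains \<Gamma>. \<forall>x\<in>nodes \<Gamma> - {z}. chain_boundary \<Gamma> x c = 0}
        + card (nodes \<Gamma> - {z})"
    using fin
    by (intro chain.dim_le_dim_kernels[OF _ span subspace_alternating_chains])
       (auto simp: chain_boundary_add chain_boundary_scale)
  ultimately have "chain.dim (alternating_chains \<Gamma>) \<le> first_betti \<Gamma> + card (nodes \<Gamma> - {z})"
    unfolding first_betti_def by simp
  moreover have "card (nodes \<Gamma>) = card (nodes \<Gamma> - {z}) + 1"
    using z fin(1) by (metis Suc_eq_plus1 card.remove)
  ultimately show ?thesis using cardP P(3) by linarith
qed

section \<open>The quotient of a tree by a finitely generated group\<close>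

text \<open>Connectivity is phrased for arbitrary \<open>V\<close> and \<open>E\<close>, since it is
  applied to an invariant subgraph before that is known to be a tree.\<close>

definition joined :: "'v set \<Rightarrow> 'v set set \<Rightarrow> 'v \<Rightarrow> 'v \<Rightarrow> bool" where
  "joined V E x y \<longleftrightarrow> (\<exists>p. walk_in V E p \<and> hd p = x \<and> last p = y)"

lemma joined_refl: "x \<in> V \<Longrightarrow> joined V E x x"
  unfolding joined_def by (rule exI[of _ "[x]"]) (simp add: walk_in_def)

lemma joined_sym: "joined V E x y \<Longrightarrow> joined V E y x"
  unfolding joined_def by (metis hd_rev last_rev walk_in_rev)

lemma joined_trans:
  assumes "joined V E x y" "joined V E y z"
  shows "joined V E x z"
proof -
  obtain p where p: "walk_in V E p" "hd p = x" "last p = y" using assms unfolding joined_def by blast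
  obtain q where q: "walk_in V E q" "hd q = y" "last q = z" using assms unfolding joined_def by blast
  obtain p' where p': "p = p' @ [y]" using p by (cases p rule: rev_cases) (auto simp: walk_in_def)
  obtain q' where q': "q = y # q'" using q by (cases q) (auto simp: walk_in_def)
  have "walk_in V E (p' @ y # q')" using p q p' q' walk_in_join by metis
  moreover have "hd (p' @ y # q') = x" using p p' by (cases p') auto
  moreover have "last (p' @ y # q') = z" using q q' by simp
  ultimately show ?thesis unfolding joined_def by blast
qed

lemma joined_map:
  assumes "joined V E x y" "\<phi> ` V \<subseteq> V" "\<And>e. e \<in> E \<Longrightarrow> \<phi> ` e \<in> E"
  shows "joined V E (\<phi> x) (\<phi> y)"
proof -
  obtain p where p: "walk_in V E p" "hd p = x" "last p = y" using assms unfolding joined_def by blast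
  have "successively (\<lambda>x y. {\<phi> x, \<phi> y} \<in> E) p"
    using p(1) assms(3)[of "{_, _}"] unfolding walk_in_def by (auto intro: successively_mono)
  then have "walk_in V E (map \<phi> p)"
    using p(1) assms(2) unfolding walk_in_def successively_map by auto
  moreover have "hd (map \<phi> p) = \<phi> x" "last (map \<phi> p) = \<phi> y"
    using p by (auto simp: walk_in_def hd_map last_map)
  ultimately show ?thesis unfolding joined_def by blast
qed

lemma joined_prefix:
  assumes "walk_in V E p" "w \<in> set p"
  shows "joined V E (hd p) w"
proof -
  obtain ys zs where p: "p = ys @ w # zs" using assms(2) split_list by metis
  then have "walk_in V E (ys @ [w])" using assms(1) walk_in_join by metis
  moreover have "hd (ys @ [w]) = hd p" using p by (cases ys) auto
  ultimately show ?thesis unfolding joined_def by (metis last_snoc)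
qed

text \<open>Finite generation is included because, together with minimality, it makes the quotient
  graph finite.\<close>

locale g_tree = group G for G :: "('g, 'b) monoid_scheme" (structure) +
  fixes T :: "('g, 'v) gtree"
  assumes G_tree: "G_tree G T" and fin_gen: "finitely_generated G"
begin

lemma tree: "simplicial_tree (vertices T) (edges T)"
  using G_tree by (simp add: G_tree_def)

sublocale group_action G "vertices T" "act T"
  using G_tree by (simp add: G_tree_def)

abbreviation vorbit :: "'v \<Rightarrow> 'v set" where
  "vorbit \<equiv> orbit G (act T)"

abbreviation arc :: "'v \<Rightarrow> 'v \<Rightarrow> ('v \<times> 'v) set" where
  "arc x y \<equiv> orbit G (\<lambda>g. map_prod (act T g) (act T g)) (x, y)"

abbreviation \<Gamma> :: "('v set, ('v \<times> 'v) set) serre_graph" where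
  "\<Gamma> \<equiv> quotient_graph G T"

lemma act_closed: "g \<in> carrier G \<Longrightarrow> x \<in> vertices T \<Longrightarrow> act T g x \<in> vertices T"
  using element_image by blast

lemma act_one: "x \<in> vertices T \<Longrightarrow> act T \<one> x = x"
  by (metis id_eq_one restrict_apply')

lemma act_inv:
  assumes "g \<in> carrier G" "x \<in> vertices T"
  shows "act T (inv g) (act T g x) = x" "act T g (act T (inv g) x) = x"
  using assms orbit_sym_aux[of g x] orbit_sym_aux[of "inv g" x] by auto

lemma edge_in: "{x, y} \<in> edges T \<Longrightarrow> x \<in> vertices T" "{x, y} \<in> edges T \<Longrightarrow> y \<in> vertices T"
  using tree_edgeD[OF tree] by blast+

lemma act_edge_closed: "g \<in> carrier G \<Longrightarrow> e \<in> edges T \<Longrightarrow> act T g ` e \<in> edges T"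
  using G_tree by (simp add: G_tree_def act_edge_def)

lemma edge_act: "g \<in> carrier G \<Longrightarrow> {x, y} \<in> edges T \<Longrightarrow> {act T g x, act T g y} \<in> edges T"
  using act_edge_closed[of g "{x, y}"] by simp

lemma no_inversion: "g \<in> carrier G \<Longrightarrow> {x, y} \<in> edges T \<Longrightarrow> act T g x = y \<Longrightarrow> act T g y \<noteq> x"
  using G_tree unfolding G_tree_def by blast

lemma minimal: "invariant_subtree G T V' E' \<Longrightarrow> V' = vertices T \<and> E' = edges T"
  using G_tree by (simp add: G_tree_def)

section \<open>Orbits of vertices and of oriented edges\<close>

lemma orbit_prod_self: "x \<in> vertices T \<Longrightarrow> y \<in> vertices T \<Longrightarrow> (x, y) \<in> arc x y"
  unfolding orbit_def by (rule CollectI, rule exI[of _ \<one>]) (simp add: act_one)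

lemma vorbit_eq_iff:
  assumes "x \<in> vertices T" "y \<in> vertices T"
  shows "vorbit x = vorbit y \<longleftrightarrow> (\<exists>g\<in>carrier G. y = act T g x)"
proof
  assume "vorbit x = vorbit y"
  then have "y \<in> vorbit x" using orbit_refl assms(2) by metis
  then show "\<exists>g\<in>carrier G. y = act T g x" unfolding orbit_def by blast
next
  assume "\<exists>g\<in>carrier G. y = act T g x"
  then have "y \<in> vorbit x" unfolding orbit_def by blast
  moreover have "y \<in> vorbit y" using orbit_refl assms(2) by blast
  moreover have "vorbit x \<in> orbits G (vertices T) (act T)" "vorbit y \<in> orbits G (vertices T) (act T)"
    using assms unfolding orbits_def by blast+
  ultimately show "vorbit x = vorbit y" using disjoint_union by blast
qed

lemma vorbit_act: "g \<in> carrier G \<Longrightarrow> x \<in> vertices T \<Longrightarrow> vorbit (act T g x) = vorbit x"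
  using vorbit_eq_iff act_closed by metis

lemma in_vorbit_iff:
  assumes "x \<in> vertices T" "y \<in> vertices T"
  shows "y \<in> vorbit x \<longleftrightarrow> vorbit x = vorbit y"
  unfolding vorbit_eq_iff[OF assms] by (auto simp: orbit_def)

text \<open>The orbit of a translated pair is contained in the orbit of the pair; applied to
  \<open>g\<close> and to \<open>inv g\<close> this gives both inclusions.\<close>

lemma arc_eq_iff:
  assumes "x \<in> vertices T" "y \<in> vertices T" "x' \<in> vertices T" "y' \<in> vertices T"
  shows "arc x y = arc x' y' \<longleftrightarrow> (\<exists>g\<in>carrier G. x' = act T g x \<and> y' = act T g y)"
proof
  assume "arc x y = arc x' y'"
  then have "(x', y') \<in> arc x y" using orbit_prod_self assms(3,4) by metis
  then show "\<exists>g\<in>carrier G. x' = act T g x \<and> y' = act T g y" unfolding orbit_def by auto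
next
  have sub: "arc (act T g u) (act T g w) \<subseteq> arc u w"
    if "g \<in> carrier G" "u \<in> vertices T" "w \<in> vertices T" for g u w
  proof
    fix e assume "e \<in> arc (act T g u) (act T g w)"
    then obtain h where h: "h \<in> carrier G" "e = (act T h (act T g u), act T h (act T g w))"
      unfolding orbit_def by auto
    then have "e = (act T (h \<otimes> g) u, act T (h \<otimes> g) w)" using that composition_rule by simp
    then show "e \<in> arc u w" using h(1) that(1) unfolding orbit_def by auto
  qed
  assume "\<exists>g\<in>carrier G. x' = act T g x \<and> y' = act T g y"
  then obtain g where g: "g \<in> carrier G" "x' = act T g x" "y' = act T g y" by blast
  then have "arc x' y' \<subseteq> arc x y" using sub assms by blast
  moreover have "arc x y \<subseteq> arc x' y'"
    using sub[of "inv g" x' y'] g assms act_inv by simp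
  ultimately show "arc x y = arc x' y'" by blast
qed

lemma arc_act:
  assumes "g \<in> carrier G" "x \<in> vertices T" "y \<in> vertices T"
  shows "arc (act T g x) (act T g y) = arc x y"
  using arc_eq_iff[of x y "act T g x" "act T g y"] assms act_closed by blast

lemma converse_arc: "converse (arc x y) = arc y x"
  unfolding orbit_def by auto

lemma Domain_arc: "Domain (arc x y) = vorbit x"
  unfolding orbit_def by force

lemma Range_arc: "Range (arc x y) = vorbit y"
  unfolding orbit_def by force

text \<open>Equality would give an element exchanging \<open>x\<close> and \<open>y\<close>, that
  is, an inversion. Hence even a loop of the quotient consists of two distinct arcs.\<close>

lemma arc_neq_converse: "{x, y} \<in> edges T \<Longrightarrow> arc y x \<noteq> arc x y"
  using arc_eq_iff[of y x x y] edge_in[of x y] no_inversion[of _ x y] by metis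

lemma quotient_graph_simps [simp]:
  "nodes \<Gamma> = vorbit ` vertices T" "origin \<Gamma> = Domain" "rev_arc \<Gamma> = converse"
  by (auto simp: quotient_graph_def orbits_def)

lemma arcs_eq: "arcs \<Gamma> = {arc x y | x y. {x, y} \<in> edges T}"
  by (auto simp: quotient_graph_def orbits_def oriented_edges_def)

lemma arc_in_arcs: "{x, y} \<in> edges T \<Longrightarrow> arc x y \<in> arcs \<Gamma>" "{x, y} \<in> edges T \<Longrightarrow> arc y x \<in> arcs \<Gamma>"
proof -
  show "arc x y \<in> arcs \<Gamma>" if "{x, y} \<in> edges T" for x y using that unfolding arcs_eq by blast
  from this[of y x] show "{x, y} \<in> edges T \<Longrightarrow> arc y x \<in> arcs \<Gamma>" by (simp add: insert_commute)
qed

lemma arcsE: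
  assumes "a \<in> arcs \<Gamma>"
  obtains x y where "a = arc x y" "{x, y} \<in> edges T"
  using assms unfolding arcs_eq by blast

lemma arcs_origin: "a \<in> arcs \<Gamma> \<Longrightarrow> Domain a \<in> nodes \<Gamma>"
  by (erule arcsE) (auto simp: Domain_arc edge_in)

lemma arcs_converse: "a \<in> arcs \<Gamma> \<Longrightarrow> converse a \<in> arcs \<Gamma> \<and> converse a \<noteq> a"
  by (erule arcsE) (auto simp: converse_arc arc_in_arcs dest: arc_neq_converse)

text \<open>By minimality the tree is covered by the translates of the paths from a base vertex to its
  images under the generators.\<close>

lemma finite_quotient: "finite (nodes \<Gamma>)" "finite (arcs \<Gamma>)"
proof -
  let ?V = "vertices T" and ?E = "edges T"
  obtain S where S: "finite S" "S \<subseteq> carrier G" "generate G S = carrier G"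
    using fin_gen unfolding finitely_generated_def by blast
  obtain v where v: "v \<in> ?V" using tree unfolding simplicial_tree_def by blast
  have "\<exists>p. walk_in ?V ?E p \<and> hd p = v \<and> last p = act T s v" if "s \<in> S" for s
    using walk_between[OF tree v act_closed] S(2) v that by (metis subsetD)
  then obtain P where P: "\<And>s. s \<in> S \<Longrightarrow> walk_in ?V ?E (P s) \<and> hd (P s) = v \<and> last (P s) = act T s v"
    by metis
  define W where "W = insert v (\<Union>s\<in>S. set (P s))"
  have W: "finite W" "W \<subseteq> ?V" using S(1) v P by (auto simp: W_def walk_in_def)
  define V' where "V' = {act T g x | g x. g \<in> carrier G \<and> x \<in> W}"
  \<comment> \<open>All edges of \<open>T\<close> with both ends in \<open>W\<close> are taken, not
    only those on the chosen paths; as \<open>W\<close> is finite, there are still only finitely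
    many orbits.\<close>
  define E' where "E' = {act T g ` e | g e. g \<in> carrier G \<and> e \<in> ?E \<and> e \<subseteq> W}"
  have V'_sub: "V' \<subseteq> ?V" using W act_closed by (auto simp: V'_def)
  have E'_sub: "E' \<subseteq> ?E" using act_edge_closed by (auto simp: E'_def)
  have W_V': "W \<subseteq> V'"
  proof
    fix x assume x: "x \<in> W"
    then have "x = act T \<one> x" using W(2) act_one by auto
    then show "x \<in> V'" using x one_closed unfolding V'_def by blast
  qed
  have E_E': "e \<in> E'" if "e \<in> ?E" "e \<subseteq> W" for e
  proof -
    have "act T \<one> x = x" if "x \<in> e" for x using that \<open>e \<subseteq> W\<close> W(2) act_one by blast
    then have "act T \<one> ` e = e" by simp
    then show ?thesis using that unfolding E'_def by (metis (mono_tags, lifting) mem_Collect_eq one_closed)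
  qed
  have act_V': "act T g ` V' \<subseteq> V'" if g: "g \<in> carrier G" for g
  proof
    fix y assume "y \<in> act T g ` V'"
    then obtain h x where h: "h \<in> carrier G" "x \<in> W" "y = act T g (act T h x)"
      unfolding V'_def by blast
    then have "y = act T (g \<otimes> h) x" using g W(2) composition_rule[of x g h] by auto
    then show "y \<in> V'" using g h m_closed unfolding V'_def by blast
  qed
  have act_E': "act T g ` e \<in> E'" if g: "g \<in> carrier G" and e: "e \<in> E'" for g e
  proof -
    obtain h d where d: "h \<in> carrier G" "d \<in> ?E" "d \<subseteq> W" "e = act T h ` d"
      using e unfolding E'_def by blast
    then have "act T (g \<otimes> h) x = act T g (act T h x)" if "x \<in> d" for x
      using g W(2) composition_rule[of x g h] that by blast
    then have "act T g ` e = act T (g \<otimes> h) ` d" using d(4) by (simp add: image_image)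
    then show ?thesis using d g m_closed unfolding E'_def by blast
  qed
  have walk: "walk_in V' E' (P s)" if s: "s \<in> S" for s
  proof -
    have w: "walk_in ?V ?E (P s)" and sub: "set (P s) \<subseteq> W" using P s by (auto simp: W_def)
    have "successively (\<lambda>x y. {x, y} \<in> E') (P s)"
    proof (rule successively_mono)
      show "successively (\<lambda>x y. {x, y} \<in> ?E) (P s)" using w by (simp add: walk_in_def)
      show "{x, y} \<in> E'" if "x \<in> set (P s)" "y \<in> set (P s)" "{x, y} \<in> ?E" for x y
        using that sub E_E' by auto
    qed
    then show ?thesis using w sub W_V' unfolding walk_in_def by blast
  qed
  have vW: "v \<in> V'" using W_V' by (auto simp: W_def)
  have joined_act: "joined V' E' (act T g x) (act T g y)" if "joined V' E' x y" "g \<in> carrier G" for g x y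
    using joined_map[OF that(1) act_V'[OF that(2)]] act_E'[OF that(2)] by blast
  \<comment> \<open>Induction over words in the generators: if \<open>v\<close> is joined to
    \<open>g v\<close> and to \<open>h v\<close>, translating the second walk by \<open>g\<close>
    joins \<open>g v\<close> to \<open>gh v\<close>.\<close>
  have "joined V' E' v (act T g v)" if "g \<in> generate G S" for g
    using that
  proof induction
    case one
    then show ?case using joined_refl[OF vW] act_one[OF v] by simp
  next
    case (incl s)
    then show ?case using walk[OF incl] P[OF incl] unfolding joined_def by blast
  next
    case (inv s)
    then have s: "s \<in> carrier G" using S(2) by blast
    have "joined V' E' v (act T s v)" using walk[OF inv] P[OF inv] unfolding joined_def by blast
    then have "joined V' E' (act T (inv s) v) (act T (inv s) (act T s v))"
      using s by (intro joined_act) auto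
    then show ?case using act_inv(1)[OF s v] joined_sym by metis
  next
    case (eng g h)
    then have gh: "g \<in> carrier G" "h \<in> carrier G" using S(3) by auto
    have "joined V' E' (act T g v) (act T g (act T h v))" using eng gh by (intro joined_act)
    then show ?case using eng joined_trans composition_rule[OF v gh] by metis
  qed
  then have base: "joined V' E' v (act T g v)" if "g \<in> carrier G" for g using S(3) that by simp
  have "joined V' E' v x" if x: "x \<in> V'" for x
  proof -
    obtain g w where gw: "g \<in> carrier G" "w \<in> W" "x = act T g w" using x unfolding V'_def by blast
    have "joined V' E' v w"
    proof (cases "w = v")
      case True
      then show ?thesis using joined_refl[OF vW] by simp
    next
      case False
      then obtain s where "s \<in> S" "w \<in> set (P s)" using gw(2) by (auto simp: W_def)
      then show ?thesis using joined_prefix[OF walk] P by metis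
    qed
    then have "joined V' E' (act T g v) x" using joined_act gw by metis
    then show ?thesis using base[OF gw(1)] joined_trans by metis
  qed
  then have conn: "joined V' E' x y" if "x \<in> V'" "y \<in> V'" for x y
    using that joined_sym joined_trans by metis
  have "simplicial_tree V' E'"
    unfolding simplicial_tree_def
  proof (intro conjI ballI)
    show "V' \<noteq> {}" using vW by blast
    show "e \<subseteq> V'" if "e \<in> E'" for e using that unfolding E'_def V'_def by blast
    show "card e = 2" if "e \<in> E'" for e using that E'_sub tree unfolding simplicial_tree_def by blast
    show "\<exists>p. walk_in V' E' p \<and> hd p = x \<and> last p = y" if "x \<in> V'" "y \<in> V'" for x y
      using conn[OF that] unfolding joined_def .
    show "\<nexists>p. cycle_in V' E' p"
    proof
      assume "\<exists>p. cycle_in V' E' p"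
      then obtain p where p: "cycle_in V' E' p" by blast
      have "successively (\<lambda>x y. {x, y} \<in> ?E) p"
        using p E'_sub unfolding cycle_in_def walk_in_def by (blast intro: successively_mono)
      then have "cycle_in ?V ?E p"
        using p V'_sub E'_sub unfolding cycle_in_def walk_in_def by blast
      then show False using tree unfolding simplicial_tree_def by blast
    qed
  qed
  moreover have "V' \<subseteq> act T g ` V'" if g: "g \<in> carrier G" for g
  proof
    fix x assume x: "x \<in> V'"
    then have "x = act T g (act T (inv g) x)" using act_inv(2)[OF g, of x] V'_sub by auto
    moreover have "act T (inv g) x \<in> V'" using act_V'[of "inv g"] g x by auto
    ultimately show "x \<in> act T g ` V'" by blast
  qed
  moreover have "E' \<subseteq> act_edge T g ` E'" if g: "g \<in> carrier G" for g
  proof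
    fix e assume e: "e \<in> E'"
    then have "e \<subseteq> ?V" using E'_sub tree unfolding simplicial_tree_def by blast
    then have "act T g (act T (inv g) x) = x" if "x \<in> e" for x using act_inv(2)[OF g] that by blast
    then have "e = act T g ` (act T (inv g) ` e)" by (simp add: image_image)
    moreover have "act T (inv g) ` e \<in> E'" using act_E'[of "inv g"] g e by auto
    ultimately show "e \<in> act_edge T g ` E'" unfolding act_edge_def by blast
  qed
  moreover have "act_edge T g ` E' \<subseteq> E'" if "g \<in> carrier G" for g
    using act_E'[OF that] by (auto simp: act_edge_def)
  ultimately have "invariant_subtree G T V' E'"
    unfolding invariant_subtree_def using V'_sub E'_sub act_V' by (metis subset_antisym)
  \<comment> \<open>The translates of \<open>W\<close> form an invariant subtree, hence the whole
    tree: \<open>W\<close> meets every vertex orbit, and every arc is the orbit of a pair from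
    \<open>W \<times> W\<close>.\<close>
  then have eq: "V' = ?V" "E' = ?E" using minimal by simp_all
  have "nodes \<Gamma> \<subseteq> vorbit ` W"
  proof
    fix n assume "n \<in> nodes \<Gamma>"
    then obtain x where x: "x \<in> V'" "n = vorbit x" using eq by auto
    then obtain g w where "g \<in> carrier G" "w \<in> W" "x = act T g w" unfolding V'_def by blast
    then show "n \<in> vorbit ` W" using x vorbit_act W by auto
  qed
  then show "finite (nodes \<Gamma>)" using W(1) finite_surj by blast
  have "arcs \<Gamma> \<subseteq> (\<lambda>(x, y). arc x y) ` (W \<times> W)"
  proof
    fix a assume "a \<in> arcs \<Gamma>"
    then obtain x y where xy: "a = arc x y" "{x, y} \<in> ?E" by (rule arcsE)
    then have "{x, y} \<in> E'" using eq by simp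
    then obtain g e where g: "g \<in> carrier G" "e \<subseteq> W" "{x, y} = act T g ` e" unfolding E'_def by blast
    have "x \<in> act T g ` e" "y \<in> act T g ` e" unfolding g(3)[symmetric] by simp_all
    then obtain u w where uw: "u \<in> e" "w \<in> e" "x = act T g u" "y = act T g w" by blast
    then have "u \<in> W" "w \<in> W" using g(2) by auto
    moreover have "arc x y = arc u w"
      unfolding uw(3,4) by (rule arc_act) (use g(1) W(2) \<open>u \<in> W\<close> \<open>w \<in> W\<close> in auto)
    ultimately show "a \<in> (\<lambda>(x, y). arc x y) ` (W \<times> W)" unfolding xy(1) by auto
  qed
  moreover have "finite (W \<times> W)" using W(1) by simp
  ultimately show "finite (arcs \<Gamma>)" using finite_surj by blast
qed

text \<open>A subgroup fixing an interior point of an edge permutes the two endpoints, and it cannot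
  exchange them since there are no inversions, so it fixes both. Conversely, a fixed vertex is a
  fixed point whose coordinates are concentrated there.\<close>

lemma elliptic_iff:
  "H \<in> elliptic_subgroups G T \<longleftrightarrow> subgroup H G \<and> (\<exists>u\<in>vertices T. H \<subseteq> stabilizer G (act T) u)"
proof (intro iffI conjI)
  assume H: "H \<in> elliptic_subgroups G T"
  then show sub: "subgroup H G" by (simp add: elliptic_subgroups_def)
  obtain p where p: "p \<in> points T" "fixes_point T H p"
    using H by (auto simp: elliptic_subgroups_def)
  have fix_p: "p (act T h x) = p x" if "h \<in> H" "x \<in> vertices T" for h x
    using p(2) that by (simp add: fixes_point_def)
  have carr: "h \<in> carrier G" if "h \<in> H" for h using subgroup.mem_carrier[OF sub that] .
  consider (edge) "{v. p v \<noteq> 0} \<in> edges T" | (vertex) u where "u \<in> vertices T" "{v. p v \<noteq> 0} = {u}"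
    using p(1) by (auto simp: points_def)
  then show "\<exists>u\<in>vertices T. H \<subseteq> stabilizer G (act T) u"
  proof cases
    case vertex
    have "act T h u = u" if "h \<in> H" for h
    proof -
      have "p u \<noteq> 0" using vertex(2) by blast
      then have "p (act T h u) \<noteq> 0" using fix_p[OF that vertex(1)] by simp
      then show ?thesis using vertex(2) by blast
    qed
    then show ?thesis using vertex(1) carr unfolding stabilizer_def by blast
  next
    case edge
    then have "card {v. p v \<noteq> 0} = 2" using tree unfolding simplicial_tree_def by blast
    then obtain u w where uw: "{v. p v \<noteq> 0} = {u, w}" "u \<noteq> w" by (metis card_2_iff)
    with edge have e: "{u, w} \<in> edges T" by simp
    have "act T h u = u" if h: "h \<in> H" for h
    proof (rule ccontr)
      have mem: "act T h x \<in> {u, w}" if "x \<in> {u, w}" for x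
      proof -
        have "p x \<noteq> 0" "x \<in> vertices T" using uw(1) that edge_in[OF e] by blast+
        then show ?thesis using fix_p[OF h] uw(1) by auto
      qed
      assume "act T h u \<noteq> u"
      then have "act T h u = w" using mem[of u] by blast
      moreover have "act T h w \<noteq> act T h u"
        using inj_prop[OF carr[OF h]] edge_in[OF e] uw(2) by (metis inj_onD)
      ultimately have "act T h w = u" using mem[of w] by auto
      then show False using no_inversion[OF carr[OF h] e] \<open>act T h u = w\<close> by blast
    qed
    then show ?thesis using edge_in(1)[OF e] carr unfolding stabilizer_def by blast
  qed
next
  assume H: "subgroup H G \<and> (\<exists>u\<in>vertices T. H \<subseteq> stabilizer G (act T) u)"
  then obtain u where u: "u \<in> vertices T" "H \<subseteq> stabilizer G (act T) u" by blast
  let ?p = "\<lambda>x. of_bool (x = u) :: real"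
  have "{v. ?p v \<noteq> 0} = {u}" by auto
  then have "?p \<in> points T" using u(1) by (auto simp: points_def)
  moreover have "fixes_point T H ?p"
    unfolding fixes_point_def
  proof (intro ballI)
    fix h x assume hx: "h \<in> H" "x \<in> vertices T"
    then have "h \<in> carrier G" "act T h u = u" using u(2) by (auto simp: stabilizer_def)
    then have "act T h x = u \<longleftrightarrow> x = u" using inj_prop hx(2) u(1) by (metis inj_onD)
    then show "?p (act T h x) = ?p x" by simp
  qed
  ultimately show "H \<in> elliptic_subgroups G T" using H by (auto simp: elliptic_subgroups_def)
qed

end

section \<open>Chains on the quotient and invariance of the Betti number\<close>

context g_tree
begin

text \<open>The image in the quotient of the oriented edge from \<open>x\<close> to
  \<open>y\<close>; subtracting the reverse arc makes it alternating.\<close>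

definition edge_chain :: "'v \<Rightarrow> 'v \<Rightarrow> ('v \<times> 'v) set \<Rightarrow>\<^sub>0 real" where
  "edge_chain x y = Poly_Mapping.single (arc x y) 1 - Poly_Mapping.single (arc y x) 1"

text \<open>The image in the quotient of the oriented path from \<open>x\<close> to
  \<open>y\<close>. By \<open>cocycle_unique\<close> its values on vertices of \<open>T\<close> do
  not depend on the choice made by \<open>SOME\<close>.\<close>

definition path_chain :: "'v \<Rightarrow> 'v \<Rightarrow> ('v \<times> 'v) set \<Rightarrow>\<^sub>0 real" where
  "path_chain = (SOME J. cocycle_on (vertices T) J \<and>
     (\<forall>x y. {x, y} \<in> edges T \<longrightarrow> J x y = edge_chain x y))"

definition invariant :: "('v \<Rightarrow> 'v \<Rightarrow> 'c) \<Rightarrow> bool" where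
  "invariant K \<longleftrightarrow> (\<forall>g\<in>carrier G. \<forall>x\<in>vertices T. \<forall>y\<in>vertices T. K (act T g x) (act T g y) = K x y)"

lemma path_chain:
  shows path_chain_cocycle: "cocycle_on (vertices T) path_chain"
    and path_chain_edge: "{x, y} \<in> edges T \<Longrightarrow> path_chain x y = edge_chain x y"
proof -
  have "edge_chain y x = - edge_chain x y" for x y by (simp add: edge_chain_def)
  from tree_cocycle_exists[OF tree this]
  have "cocycle_on (vertices T) path_chain \<and> (\<forall>x y. {x, y} \<in> edges T \<longrightarrow> path_chain x y = edge_chain x y)"
    unfolding path_chain_def by (rule someI_ex)
  then show "cocycle_on (vertices T) path_chain" "{x, y} \<in> edges T \<Longrightarrow> path_chain x y = edge_chain x y"
    by blast+
qed

lemma edge_chain_act: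
  assumes "g \<in> carrier G" "{x, y} \<in> edges T"
  shows "edge_chain (act T g x) (act T g y) = edge_chain x y"
  unfolding edge_chain_def using assms by (simp add: arc_act edge_in)

text \<open>Arcs are orbits, so translated edges have the same chain, and agreement on edges
  suffices for cocycles.\<close>

lemma path_chain_act:
  assumes g: "g \<in> carrier G" and "x \<in> vertices T" "y \<in> vertices T"
  shows "path_chain (act T g x) (act T g y) = path_chain x y"
proof (rule cocycle_unique[OF tree _ path_chain_cocycle _ assms(2,3)])
  show "cocycle_on (vertices T) (\<lambda>x y. path_chain (act T g x) (act T g y))"
    unfolding cocycle_on_def using cocycle_onD[OF path_chain_cocycle] act_closed[OF g] by blast
  show "path_chain (act T g u) (act T g w) = path_chain u w" if "{u, w} \<in> edges T" for u w
    using path_chain_edge[OF that] path_chain_edge[OF edge_act[OF g that]] edge_chain_act[OF g that]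
    by simp
qed

text \<open>Nodes are sets of vertices, so \<open>x \<in> n\<close> means that \<open>x\<close> lies
  over \<open>n\<close>. If both ends lie over \<open>n\<close>, the two arcs of the loop
  cancel.\<close>

lemma edge_chain_boundary:
  assumes "{x, y} \<in> edges T" "n \<in> nodes \<Gamma>"
  shows "chain_boundary \<Gamma> n (edge_chain x y) = of_bool (x \<in> n) - of_bool (y \<in> n)"
proof -
  have single: "chain_boundary \<Gamma> n (Poly_Mapping.single a 1) = of_bool (Domain a = n)" if "a \<in> arcs \<Gamma>" for a
  proof -
    have "chain_boundary \<Gamma> n (Poly_Mapping.single a 1)
        = (\<Sum>b\<in>{b \<in> arcs \<Gamma>. Domain b = n}. if a = b then 1 else 0)"
      unfolding chain_boundary_def by (simp add: lookup_single when_def)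
    also have "\<dots> = of_bool (Domain a = n)" using finite_quotient(2) that by simp
    finally show ?thesis .
  qed
  have mem: "vorbit z = n \<longleftrightarrow> z \<in> n" if "z \<in> vertices T" for z
    using assms(2) that in_vorbit_iff by auto
  have "chain_boundary \<Gamma> n (edge_chain x y) + chain_boundary \<Gamma> n (Poly_Mapping.single (arc y x) 1)
      = chain_boundary \<Gamma> n (Poly_Mapping.single (arc x y) 1)"
    unfolding chain_boundary_add[symmetric] edge_chain_def by simp
  then show ?thesis
    using single arc_in_arcs[OF assms(1)] mem edge_in[OF assms(1)] by (simp add: Domain_arc)
qed

text \<open>The contributions of the interior vertices of the path telescope; formally, both sides
  are cocycles that agree on edges.\<close>

lemma path_chain_boundary:
  assumes "n \<in> nodes \<Gamma>" "x \<in> vertices T" "y \<in> vertices T"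
  shows "chain_boundary \<Gamma> n (path_chain x y) = of_bool (x \<in> n) - of_bool (y \<in> n)"
proof (rule cocycle_unique[OF tree _ _ _ assms(2,3)])
  show "cocycle_on (vertices T) (\<lambda>x y. chain_boundary \<Gamma> n (path_chain x y))"
    unfolding cocycle_on_def
    using cocycle_onD[OF path_chain_cocycle] chain_boundary_add[of \<Gamma> n] by metis
  show "cocycle_on (vertices T) (\<lambda>x y. of_bool (x \<in> n) - of_bool (y \<in> n))"
    unfolding cocycle_on_def by simp
  show "chain_boundary \<Gamma> n (path_chain u w) = of_bool (u \<in> n) - of_bool (w \<in> n)"
    if "{u, w} \<in> edges T" for u w
    using path_chain_edge[OF that] edge_chain_boundary[OF that assms(1)] by simp
qed

lemma edge_chain_alternating:
  assumes "{x, y} \<in> edges T"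
  shows "edge_chain x y \<in> alternating_chains \<Gamma>"
proof -
  have "arc x y = converse a \<longleftrightarrow> arc y x = a" "arc y x = converse a \<longleftrightarrow> arc x y = a" for a
    unfolding converse_arc[of y x, symmetric] by auto
  then have "Poly_Mapping.lookup (edge_chain x y) (converse a) = - Poly_Mapping.lookup (edge_chain x y) a" for a
    by (simp add: edge_chain_def lookup_minus lookup_single when_def)
  moreover have "Poly_Mapping.keys (edge_chain x y) \<subseteq> {arc x y, arc y x}"
    by (auto simp: edge_chain_def in_keys_iff lookup_minus lookup_single when_def split: if_splits)
  then have "Poly_Mapping.keys (edge_chain x y) \<subseteq> arcs \<Gamma>" using arc_in_arcs[OF assms] by blast
  ultimately show ?thesis by (simp add: alternating_chains_def)
qed

lemma path_chain_alternating:
  assumes "x \<in> vertices T" "y \<in> vertices T"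
  shows "path_chain x y \<in> alternating_chains \<Gamma>"
  using tree assms
proof (induction rule: tree_induct)
  case base
  then show ?case
    using cocycle_on_refl[OF path_chain_cocycle assms(1)]
      chain.subspace_0[OF subspace_alternating_chains] by simp
next
  case (step u w)
  have "path_chain x w = path_chain x u + edge_chain u w"
    using cocycle_onD[OF path_chain_cocycle, of x u w] assms(1) edge_in[OF step.hyps(2)]
      path_chain_edge[OF step.hyps(2)] by simp
  then show ?case
    using chain.subspace_add[OF subspace_alternating_chains step.IH edge_chain_alternating[OF step.hyps(2)]]
    by simp
qed

section \<open>Evaluating functions of vertex pairs on chains\<close>

definition arc_source :: "('v \<times> 'v) set \<Rightarrow> 'v" where "arc_source a = fst (SOME e. e \<in> a)"
definition arc_target :: "('v \<times> 'v) set \<Rightarrow> 'v" where "arc_target a = snd (SOME e. e \<in> a)"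

text \<open>\<open>arc_source\<close> and \<open>arc_target\<close> are the components of one and
  the same chosen pair, so they are adjacent and represent the arc.\<close>

lemma arc_representative:
  assumes "a \<in> arcs \<Gamma>"
  shows "{arc_source a, arc_target a} \<in> edges T" "arc (arc_source a) (arc_target a) = a"
proof -
  obtain x y where a: "a = arc x y" "{x, y} \<in> edges T" using assms by (rule arcsE)
  have "(x, y) \<in> a" unfolding a(1) using orbit_prod_self edge_in[OF a(2)] by blast
  then have "(arc_source a, arc_target a) \<in> a"
    unfolding arc_source_def arc_target_def prod.collapse by (rule someI)
  then obtain g where g: "g \<in> carrier G" "arc_source a = act T g x" "arc_target a = act T g y"
    unfolding a(1) orbit_def by auto
  then show "{arc_source a, arc_target a} \<in> edges T" using edge_act a(2) by simp
  show "arc (arc_source a) (arc_target a) = a" using g arc_act edge_in[OF a(2)] a(1) by simp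
qed

lemma arc_source_in: "a \<in> arcs \<Gamma> \<Longrightarrow> arc_source a \<in> vertices T"
  and arc_target_in: "a \<in> arcs \<Gamma> \<Longrightarrow> arc_target a \<in> vertices T"
  using arc_representative(1) edge_in by blast+

lemma invariant_arc_representative:
  assumes K: "invariant K" and xy: "{x, y} \<in> edges T"
  shows "K (arc_source (arc x y)) (arc_target (arc x y)) = K x y"
proof -
  let ?a = "arc x y"
  have a: "?a \<in> arcs \<Gamma>" using arc_in_arcs[OF xy] by blast
  have V: "x \<in> vertices T" "y \<in> vertices T" using edge_in[OF xy] .
  have "arc (arc_source ?a) (arc_target ?a) = arc x y" using arc_representative(2)[OF a] .
  then obtain g where g: "g \<in> carrier G" "x = act T g (arc_source ?a)" "y = act T g (arc_target ?a)"
    using arc_eq_iff[OF arc_source_in[OF a] arc_target_in[OF a] V] by blast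
  then have "K (act T g (arc_source ?a)) (act T g (arc_target ?a)) = K (arc_source ?a) (arc_target ?a)"
    using K arc_source_in[OF a] arc_target_in[OF a] unfolding invariant_def by blast
  then show ?thesis unfolding g(2,3)[symmetric] by (rule sym)
qed

text \<open>The linear extension of \<open>K\<close> from arcs to chains. The sum runs over all
  arcs, so every edge is read in both directions; this is the source of the factors \<open>2\<close>
  below.\<close>

definition chain_eval :: "('v \<Rightarrow> 'v \<Rightarrow> 'c \<Rightarrow>\<^sub>0 real) \<Rightarrow> (('v \<times> 'v) set \<Rightarrow>\<^sub>0 real) \<Rightarrow> 'c \<Rightarrow>\<^sub>0 real" where
  "chain_eval K c =
     (\<Sum>a\<in>arcs \<Gamma>. chain_scale (Poly_Mapping.lookup c a) (K (arc_source a) (arc_target a)))"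

lemma linear_chain_eval: "Vector_Spaces.linear chain_scale chain_scale (chain_eval K)"
  unfolding Vector_Spaces.linear_iff chain_eval_def
  by (simp add: vector_space_chain_scale lookup_add lookup_chain_scale chain.scale_left_distrib
      sum.distrib chain.scale_sum_right)

lemmas chain_eval_add = chain_pair.linear_add[OF linear_chain_eval]
  and chain_eval_diff = chain_pair.linear_diff[OF linear_chain_eval]
  and chain_eval_sum = chain_pair.linear_sum[OF linear_chain_eval]
  and chain_eval_scale = chain_pair.linear_scale[OF linear_chain_eval]

lemma chain_eval_single:
  assumes "a \<in> arcs \<Gamma>"
  shows "chain_eval K (Poly_Mapping.single a 1) = K (arc_source a) (arc_target a)"
proof -
  have "chain_eval K (Poly_Mapping.single a 1)
      = (\<Sum>b\<in>arcs \<Gamma>. if a = b then K (arc_source b) (arc_target b) else 0)"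
    unfolding chain_eval_def by (intro sum.cong) (auto simp: lookup_single when_def)
  then show ?thesis using assms finite_quotient(2) by simp
qed

lemma chain_eval_edge_chain:
  assumes "invariant K" "cocycle_on (vertices T) K" and xy: "{x, y} \<in> edges T"
  shows "chain_eval K (edge_chain x y) = chain_scale 2 (K x y)"
proof -
  have yx: "{y, x} \<in> edges T" using xy by (simp add: insert_commute)
  have "chain_eval K (edge_chain x y) = K x y - K y x"
    unfolding edge_chain_def chain_eval_diff
      chain_eval_single[OF arc_in_arcs(1)[OF xy]] chain_eval_single[OF arc_in_arcs(2)[OF xy]]
      invariant_arc_representative[OF assms(1) xy] invariant_arc_representative[OF assms(1) yx] ..
  also have "\<dots> = K x y + K x y" using cocycle_on_swap[OF assms(2) edge_in[OF xy]] by simp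
  also have "\<dots> = chain_scale 2 (K x y)"
    by (rule poly_mapping_eqI) (simp add: lookup_add lookup_chain_scale)
  finally show ?thesis .
qed

text \<open>Both sides are cocycles that agree on edges. Evaluation on a projected path thus
  recovers \<open>K\<close> between its endpoints, which makes composites of pushforwards
  computable.\<close>

lemma chain_eval_path_chain:
  assumes K: "invariant K" "cocycle_on (vertices T) K" and "x \<in> vertices T" "y \<in> vertices T"
  shows "chain_eval K (path_chain x y) = chain_scale 2 (K x y)"
proof (rule cocycle_unique[OF tree _ _ _ assms(3,4)])
  show "cocycle_on (vertices T) (\<lambda>x y. chain_eval K (path_chain x y))"
    unfolding cocycle_on_def
    using cocycle_onD[OF path_chain_cocycle] chain_eval_add[of K] by metis
  show "cocycle_on (vertices T) (\<lambda>x y. chain_scale 2 (K x y))"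
    unfolding cocycle_on_def using cocycle_onD[OF K(2)] chain.scale_right_distrib by metis
  show "chain_eval K (path_chain u w) = chain_scale 2 (K u w)" if "{u, w} \<in> edges T" for u w
    using path_chain_edge[OF that] chain_eval_edge_chain[OF K that] by simp
qed

lemma sum_converse_arcs: "(\<Sum>a\<in>arcs \<Gamma>. f (converse a)) = (\<Sum>a\<in>arcs \<Gamma>. f a)"
  by (rule sum.reindex_bij_witness[of _ converse converse]) (auto simp: arcs_converse)

text \<open>The coefficient at \<open>b\<close> receives one contribution from \<open>b\<close> and
  one from its reverse; for an alternating chain the two are equal.\<close>

lemma chain_eval_path_chain_alternating:
  assumes c: "c \<in> alternating_chains \<Gamma>"
  shows "chain_eval path_chain c = chain_scale 2 c"
proof (rule poly_mapping_eqI)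
  fix b :: "('v \<times> 'v) set"
  have rep: "path_chain (arc_source a) (arc_target a)
      = Poly_Mapping.single a 1 - Poly_Mapping.single (converse a) 1" if "a \<in> arcs \<Gamma>" for a
    using path_chain_edge[OF arc_representative(1)[OF that]] arc_representative(2)[OF that]
      converse_arc[of "arc_source a" "arc_target a"] by (simp add: edge_chain_def)
  have swap: "converse a = b \<longleftrightarrow> a = converse b" for a by (metis converse_converse)
  have "Poly_Mapping.lookup (chain_eval path_chain c) b
      = (\<Sum>a\<in>arcs \<Gamma>. Poly_Mapping.lookup c a * (of_bool (a = b) - of_bool (a = converse b)))"
    unfolding chain_eval_def lookup_sum
    by (intro sum.cong) (auto simp: rep lookup_chain_scale lookup_minus lookup_single when_def swap)
  also have "\<dots> = (\<Sum>a\<in>arcs \<Gamma>. if a = b then Poly_Mapping.lookup c a else 0)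
      - (\<Sum>a\<in>arcs \<Gamma>. if a = converse b then Poly_Mapping.lookup c a else 0)"
    unfolding sum_subtractf[symmetric] by (intro sum.cong) auto
  also have "\<dots> = of_bool (b \<in> arcs \<Gamma>) * Poly_Mapping.lookup c b
      - of_bool (converse b \<in> arcs \<Gamma>) * Poly_Mapping.lookup c (converse b)"
    using finite_quotient(2) by simp
  also have "\<dots> = 2 * Poly_Mapping.lookup c b"
  proof (cases "b \<in> arcs \<Gamma>")
    case True
    then show ?thesis using c arcs_converse[OF True] by (simp add: alternating_chains_def)
  next
    case False
    then have "converse b \<notin> arcs \<Gamma>" using arcs_converse by (metis converse_converse)
    moreover have "Poly_Mapping.lookup c b = 0"
      using False c by (auto simp: alternating_chains_def in_keys_iff)
    ultimately show ?thesis using False by simp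
  qed
  finally show "Poly_Mapping.lookup (chain_eval path_chain c) b = Poly_Mapping.lookup (chain_scale 2 c) b"
    by (simp add: lookup_chain_scale)
qed

text \<open>Summation by parts: reversing arcs turns the target terms into source terms of opposite
  sign, and grouping the source terms by origin leaves the boundary of \<open>c\<close>, which is
  zero.\<close>

lemma cycle_coboundary:
  fixes P :: "'v \<Rightarrow> real"
  assumes c: "c \<in> cycle_space \<Gamma>"
    and P: "\<And>g x. g \<in> carrier G \<Longrightarrow> x \<in> vertices T \<Longrightarrow> P (act T g x) = P x"
  shows "(\<Sum>a\<in>arcs \<Gamma>. Poly_Mapping.lookup c a * (P (arc_source a) - P (arc_target a))) = 0"
proof -
  have c': "c \<in> alternating_chains \<Gamma>" "\<And>n. n \<in> nodes \<Gamma> \<Longrightarrow> chain_boundary \<Gamma> n c = 0"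
    using c unfolding cycle_space_eq[OF finite_quotient(2)] by blast+
  \<comment> \<open>\<open>Q\<close> is the function on nodes induced by \<open>P\<close>; by
    invariance any representative of the orbit gives the same value.\<close>
  define Q where "Q n = P (SOME x. x \<in> n)" for n
  have Q: "Q (vorbit x) = P x" if x: "x \<in> vertices T" for x
  proof -
    have "(SOME y. y \<in> vorbit x) \<in> vorbit x" using orbit_refl[OF x] by (rule someI)
    then show ?thesis unfolding Q_def using P[OF _ x] unfolding orbit_def by auto
  qed
  have source: "P (arc_source a) = Q (Domain a)" and target: "P (arc_target a) = Q (Domain (converse a))"
    if "a \<in> arcs \<Gamma>" for a
    using Q[OF arc_source_in[OF that]] Q[OF arc_target_in[OF that]] arc_representative(2)[OF that]
      Domain_arc[of "arc_source a" "arc_target a"] Range_arc[of "arc_source a" "arc_target a"]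
    by (simp_all add: Domain_converse)
  have "(\<Sum>a\<in>arcs \<Gamma>. Poly_Mapping.lookup c a * P (arc_target a))
      = (\<Sum>a\<in>arcs \<Gamma>. - (Poly_Mapping.lookup c (converse a) * Q (Domain (converse a))))"
    using c'(1) by (intro sum.cong) (auto simp: alternating_chains_def target)
  also have "\<dots> = - (\<Sum>a\<in>arcs \<Gamma>. Poly_Mapping.lookup c a * Q (Domain a))"
    unfolding sum_negf using sum_converse_arcs[of "\<lambda>a. Poly_Mapping.lookup c a * Q (Domain a)"] by simp
  finally have "(\<Sum>a\<in>arcs \<Gamma>. Poly_Mapping.lookup c a * (P (arc_source a) - P (arc_target a)))
      = 2 * (\<Sum>a\<in>arcs \<Gamma>. Poly_Mapping.lookup c a * Q (Domain a))"
    by (simp add: algebra_simps sum_subtractf source)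
  also have "(\<Sum>a\<in>arcs \<Gamma>. Poly_Mapping.lookup c a * Q (Domain a))
      = (\<Sum>n\<in>nodes \<Gamma>. \<Sum>a\<in>{a \<in> arcs \<Gamma>. origin \<Gamma> a = n}. Poly_Mapping.lookup c a * Q (Domain a))"
    by (rule sum_over_origins[OF finite_quotient, symmetric]) (use arcs_origin in auto)
  also have "\<dots> = (\<Sum>n\<in>nodes \<Gamma>. chain_boundary \<Gamma> n c * Q n)"
    unfolding chain_boundary_def sum_distrib_right by (intro sum.cong) auto
  also have "\<dots> = 0" using c'(2) by simp
  finally show ?thesis by simp
qed

lemma lookup_chain_eval:
  "Poly_Mapping.lookup (chain_eval K c) i
    = (\<Sum>a\<in>arcs \<Gamma>. Poly_Mapping.lookup c a * Poly_Mapping.lookup (K (arc_source a) (arc_target a)) i)"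
  by (simp add: chain_eval_def lookup_sum lookup_chain_scale)

text \<open>Cochains that differ by the coboundary of an invariant function agree on cycles. As
  \<open>P\<close> is chain-valued, \<open>cycle_coboundary\<close> is applied to each
  coefficient.\<close>

lemma chain_eval_homologous:
  assumes c: "c \<in> cycle_space \<Gamma>"
    and P: "\<And>g x. g \<in> carrier G \<Longrightarrow> x \<in> vertices T \<Longrightarrow> P (act T g x) = P x"
    and KL: "\<And>x y. {x, y} \<in> edges T \<Longrightarrow> K x y = L x y + (P x - P y)"
  shows "chain_eval K c = chain_eval L c"
proof (rule poly_mapping_eqI)
  fix i
  have "Poly_Mapping.lookup (chain_eval K c) i - Poly_Mapping.lookup (chain_eval L c) i
    = (\<Sum>a\<in>arcs \<Gamma>. Poly_Mapping.lookup c a *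
        (Poly_Mapping.lookup (P (arc_source a)) i - Poly_Mapping.lookup (P (arc_target a)) i))"
    unfolding lookup_chain_eval sum_subtractf[symmetric]
    by (intro sum.cong) (auto simp: KL[OF arc_representative(1)] lookup_add lookup_minus algebra_simps)
  also have "\<dots> = 0" by (rule cycle_coboundary[OF c]) (simp add: P)
  finally show "Poly_Mapping.lookup (chain_eval K c) i = Poly_Mapping.lookup (chain_eval L c) i" by simp
qed

end

section \<open>Pushing cycles forward along equivariant maps\<close>

locale g_tree_map = A: g_tree G T + B: g_tree G T'
  for G :: "('g, 'b) monoid_scheme" (structure) and T :: "('g, 'v) gtree" and T' :: "('g, 'w) gtree" +
  fixes F :: "'v \<Rightarrow> 'w"
  assumes F_in: "x \<in> vertices T \<Longrightarrow> F x \<in> vertices T'"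
    and F_act: "g \<in> carrier G \<Longrightarrow> x \<in> vertices T \<Longrightarrow> F (act T g x) = act T' g (F x)"
begin

text \<open>\<open>F\<close> may send adjacent vertices to distant ones, so an edge is sent to the
  projected path between the images of its ends.\<close>

definition image_path :: "'v \<Rightarrow> 'v \<Rightarrow> ('w \<times> 'w) set \<Rightarrow>\<^sub>0 real" where
  "image_path x y = B.path_chain (F x) (F y)"

lemma image_path_invariant: "A.invariant image_path"
  unfolding A.invariant_def image_path_def by (simp add: F_act B.path_chain_act F_in)

lemma image_path_cocycle: "cocycle_on (vertices T) image_path"
  unfolding cocycle_on_def image_path_def
  using cocycle_onD[OF B.path_chain_cocycle] F_in by blast

text \<open>The boundary of the image at \<open>n\<close> is the pairing of \<open>c\<close> with
  the coboundary of the indicator of \<open>F x \<in> n\<close>. This indicator is invariant, so the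
  pairing vanishes.\<close>

lemma pushforward_cycle:
  assumes c: "c \<in> cycle_space A.\<Gamma>"
  shows "A.chain_eval image_path c \<in> cycle_space B.\<Gamma>"
proof -
  have "A.chain_eval image_path c \<in> alternating_chains B.\<Gamma>"
    unfolding A.chain_eval_def image_path_def
    by (intro chain.subspace_sum[OF subspace_alternating_chains]
        chain.subspace_scale[OF subspace_alternating_chains] B.path_chain_alternating
        F_in A.arc_source_in A.arc_target_in)
  moreover have "chain_boundary B.\<Gamma> n (A.chain_eval image_path c) = 0" if n: "n \<in> nodes B.\<Gamma>" for n
  proof -
    have inv: "act T' g y \<in> n \<longleftrightarrow> y \<in> n" if "g \<in> carrier G" "y \<in> vertices T'" for g y
      using n that B.in_vorbit_iff B.vorbit_act B.act_closed by auto
    have sum: "chain_boundary B.\<Gamma> n (\<Sum>a\<in>A. f a) = (\<Sum>a\<in>A. chain_boundary B.\<Gamma> n (f a))"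
      for A and f :: "('v \<times> 'v) set \<Rightarrow> _"
      unfolding chain_boundary_def lookup_sum by (rule sum.swap)
    have "chain_boundary B.\<Gamma> n (A.chain_eval image_path c)
        = (\<Sum>a\<in>arcs A.\<Gamma>. Poly_Mapping.lookup c a *
            (of_bool (F (A.arc_source a) \<in> n) - of_bool (F (A.arc_target a) \<in> n)))"
      unfolding A.chain_eval_def sum image_path_def
      by (intro sum.cong)
         (simp_all add: chain_boundary_scale B.path_chain_boundary[OF n] F_in A.arc_source_in A.arc_target_in)
    also have "\<dots> = 0"
      by (rule A.cycle_coboundary[OF c, of "\<lambda>x. of_bool (F x \<in> n)"]) (simp add: F_act inv F_in)
    finally show ?thesis .
  qed
  ultimately show ?thesis unfolding cycle_space_eq[OF B.finite_quotient(2)] by blast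
qed

end

text \<open>For equivariant maps \<open>F\<close> and \<open>H\<close> in opposite directions, the paths from \<open>x\<close> to \<open>H (F x)\<close>
  project to an equivariant homotopy from the identity to \<open>H \<circ> F\<close>, so the
  latter acts on cycles as the identity.\<close>

lemma first_betti_le:
  assumes "g_tree_map G T T' F" "g_tree_map G T' T H"
  shows "first_betti (quotient_graph G T) \<le> first_betti (quotient_graph G T')"
proof -
  interpret F: g_tree_map G T T' F by (rule assms(1))
  interpret H: g_tree_map G T' T H by (rule assms(2))
  let ?\<Gamma> = "F.A.\<Gamma>" and ?\<Gamma>' = "F.B.\<Gamma>"
  let ?f = "F.A.chain_eval F.image_path" and ?h = "F.B.chain_eval H.image_path"
  let ?path = F.A.path_chain
  \<comment> \<open>One factor 2 comes from applying \<open>?h\<close> to projected paths, the other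
    from evaluating \<open>?path\<close> on an alternating chain.\<close>
  have hf: "?h (?f c) = chain_scale 4 c" if c: "c \<in> cycle_space ?\<Gamma>" for c
  proof -
    have "?h (F.image_path x y) = chain_scale 2 (?path (H (F x)) (H (F y)))"
      if "x \<in> vertices T" "y \<in> vertices T" for x y
      unfolding F.image_path_def H.image_path_def[symmetric]
      using that by (intro F.B.chain_eval_path_chain H.image_path_invariant H.image_path_cocycle F.F_in)
    then have "?h (?f c) = chain_scale 2 (F.A.chain_eval (\<lambda>x y. ?path (H (F x)) (H (F y))) c)"
      unfolding F.A.chain_eval_def[of F.image_path] F.A.chain_eval_def[of "\<lambda>x y. ?path (H (F x)) (H (F y))"]
        F.B.chain_eval_sum F.B.chain_eval_scale chain.scale_sum_right
      by (intro sum.cong) (simp_all add: F.A.arc_source_in F.A.arc_target_in mult.commute)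
    also have "F.A.chain_eval (\<lambda>x y. ?path (H (F x)) (H (F y))) c = F.A.chain_eval ?path c"
    \<comment> \<open>\<open>P\<close> records the track of \<open>x\<close> under the homotopy. Its
      sign results from computing the path from \<open>x\<close> to \<open>H (F y)\<close> once
      through \<open>H (F x)\<close> and once through \<open>y\<close>.\<close>
    proof (rule F.A.chain_eval_homologous[OF c, where P = "\<lambda>x. - ?path x (H (F x))"])
      show "- ?path (act T g x) (H (F (act T g x))) = - ?path x (H (F x))"
        if "g \<in> carrier G" "x \<in> vertices T" for g x
        using that by (simp add: F.F_act H.F_act F.F_in H.F_in F.A.path_chain_act)
      show "?path (H (F x)) (H (F y)) = ?path x y + (- ?path x (H (F x)) - - ?path y (H (F y)))"
        if "{x, y} \<in> edges T" for x y
      proof -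
        have V: "x \<in> vertices T" "y \<in> vertices T" "H (F x) \<in> vertices T" "H (F y) \<in> vertices T"
          using F.A.edge_in[OF that] F.F_in H.F_in by blast+
        have "?path x (H (F y)) = ?path x (H (F x)) + ?path (H (F x)) (H (F y))"
          "?path x (H (F y)) = ?path x y + ?path y (H (F y))"
          using cocycle_onD[OF F.A.path_chain_cocycle] V by blast+
        then show ?thesis by (simp add: algebra_simps)
      qed
    qed
    also have "\<dots> = chain_scale 2 c"
      using c unfolding cycle_space_eq[OF F.A.finite_quotient(2)]
      by (intro F.A.chain_eval_path_chain_alternating) blast
    finally show ?thesis by simp
  qed
  have "inj_on ?f (cycle_space ?\<Gamma>)"
  proof (rule inj_onI)
    fix c d assume "c \<in> cycle_space ?\<Gamma>" "d \<in> cycle_space ?\<Gamma>" "?f c = ?f d"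
    then have "chain_scale 4 c = chain_scale 4 d" using hf by metis
    then show "c = d" by simp
  qed
  moreover have "chain.subspace (cycle_space ?\<Gamma>)"
    unfolding cycle_space_eq[OF F.A.finite_quotient(2)] chain.subspace_def
    using subspace_alternating_chains[of ?\<Gamma>] unfolding chain.subspace_def
    by (auto simp: chain_boundary_add chain_boundary_scale chain_boundary_def[of _ _ 0])
  moreover have "cycle_space ?\<Gamma>' \<subseteq> chain.span ((\<lambda>a. Poly_Mapping.single a 1) ` arcs ?\<Gamma>')"
    using chain_in_span_singles[OF F.B.finite_quotient(2)] unfolding cycle_space_def by blast
  ultimately show ?thesis
    unfolding first_betti_def
    using F.pushforward_cycle F.B.finite_quotient(2)
    by (intro chain_pair.dim_le_of_linear_inj_on[OF F.A.linear_chain_eval]) auto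
qed

section \<open>Equivariant maps between trees with comparable elliptic subgroups\<close>

lemma in_orbitD: "y \<in> orbit G \<phi> x \<Longrightarrow> \<exists>g. g \<in> carrier G \<and> \<phi> g x = y"
  by (auto simp: orbit_def)

text \<open>The stabilizer of a vertex of \<open>T\<close> is elliptic in \<open>T'\<close>, hence
  fixes a vertex there. Each orbit representative \<open>r x\<close> is sent to such a vertex, and
  the map is extended along the orbit by the transporters \<open>k x\<close>.\<close>

lemma equivariant_map_exists:
  fixes G :: "('g, 'b) monoid_scheme" (structure)
  assumes "g_tree G T" "g_tree G T'" "elliptic_subgroups G T \<subseteq> elliptic_subgroups G T'"
  obtains F where "g_tree_map G T T' F"
proof -
  interpret A: g_tree G T by (rule assms(1))
  interpret B: g_tree G T' by (rule assms(2))
  have "\<exists>u\<in>vertices T'. stabilizer G (act T) x \<subseteq> stabilizer G (act T') u" if x: "x \<in> vertices T" for x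
  proof -
    have "stabilizer G (act T) x \<in> elliptic_subgroups G T"
      unfolding A.elliptic_iff using x A.stabilizer_subgroup by blast
    then show ?thesis using assms(3) B.elliptic_iff by blast
  qed
  then obtain u where u: "\<And>x. x \<in> vertices T \<Longrightarrow> u x \<in> vertices T'"
    "\<And>x. x \<in> vertices T \<Longrightarrow> stabilizer G (act T) x \<subseteq> stabilizer G (act T') (u x)" by metis
  define r where "r x = (SOME y. y \<in> A.vorbit x)" for x
  define k where "k x = (SOME g. g \<in> carrier G \<and> act T g (r x) = x)" for x
  define F where "F x = act T' (k x) (u (r x))" for x
  have r: "r x \<in> vertices T \<and> r x \<in> A.vorbit x" if x: "x \<in> vertices T" for x
  proof -
    have mem: "r x \<in> A.vorbit x" unfolding r_def using A.orbit_refl[OF x] by (rule someI)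
    then obtain g where "g \<in> carrier G" "r x = act T g x" by (auto simp: orbit_def)
    then show ?thesis using A.act_closed[OF _ x] mem by metis
  qed
  have k: "k x \<in> carrier G \<and> act T (k x) (r x) = x" if x: "x \<in> vertices T" for x
  proof -
    have "x \<in> A.vorbit (r x)" using r[OF x] x A.orbit_sym by blast
    then have "\<exists>g. g \<in> carrier G \<and> act T g (r x) = x" by (rule in_orbitD)
    then show ?thesis unfolding k_def by (rule someI_ex)
  qed
  have "g_tree_map G T T' F"
  proof
    show "F x \<in> vertices T'" if "x \<in> vertices T" for x
      unfolding F_def using k[OF that] r[OF that] u(1) B.act_closed by blast
    fix g x assume g: "g \<in> carrier G" and x: "x \<in> vertices T"
    let ?y = "act T g x"
    have y: "?y \<in> vertices T" using A.act_closed[OF g x] .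
    have ry: "r ?y = r x" unfolding r_def using A.vorbit_act[OF g x] by simp
    note kx = k[OF x] and ky = k[OF y, unfolded ry] and rx = r[OF x]
    \<comment> \<open>\<open>s\<close> compares the two ways of transporting the representative to
      \<open>?y\<close>. It fixes the representative, hence also the image of the
      representative.\<close>
    define s where "s = inv (k ?y) \<otimes> (g \<otimes> k x)"
    have s: "s \<in> carrier G" using kx ky g by (simp add: s_def)
    have "act T (g \<otimes> k x) (r x) = ?y" using kx g rx A.composition_rule by simp
    moreover have "act T (inv (k ?y)) ?y = r x" using A.act_inv(1)[of "k ?y" "r x"] ky rx by simp
    ultimately have "act T s (r x) = r x"
      unfolding s_def using A.composition_rule[of "r x" "inv (k ?y)" "g \<otimes> k x"] kx ky g rx by simp
    then have "s \<in> stabilizer G (act T) (r x)" using s by (simp add: stabilizer_def)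
    then have su: "act T' s (u (r x)) = u (r x)" using u(2) rx by (auto simp: stabilizer_def)
    have "k ?y \<otimes> s = g \<otimes> k x"
      unfolding s_def using kx ky g by (simp add: A.m_assoc[symmetric])
    then have "act T' (k ?y) (act T' s (u (r x))) = act T' (g \<otimes> k x) (u (r x))"
      using B.composition_rule[of "u (r x)" "k ?y" s] u(1) rx ky s by simp
    then show "F ?y = act T' g (F x)"
      unfolding F_def ry su using B.composition_rule u(1) rx kx g by simp
  qed
  then show ?thesis using that by blast
qed

lemma first_betti_eq:
  assumes "g_tree G T" "g_tree G T'" "elliptic_subgroups G T = elliptic_subgroups G T'"
  shows "first_betti (quotient_graph G T) = first_betti (quotient_graph G T')"
proof -
  obtain F where F: "g_tree_map G T T' F" using equivariant_map_exists assms by blast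
  obtain H where H: "g_tree_map G T' T H" using equivariant_map_exists assms by blast
  show ?thesis using first_betti_le[OF F H] first_betti_le[OF H F] by (rule antisym)
qed

section \<open>The vertical set\<close>

context group
begin

lemma conj_le_iff:
  "conj_le G H K \<longleftrightarrow> (\<exists>g\<in>carrier G. \<forall>h\<in>H. \<exists>k\<in>K. h = g \<otimes> k \<otimes> inv g)"
  unfolding conj_le_def l_coset_def r_coset_def by (auto simp: subset_iff)

lemma conj_le_mono: "H \<subseteq> K \<Longrightarrow> K \<subseteq> carrier G \<Longrightarrow> conj_le G H K"
  unfolding conj_le_iff by (rule bexI[of _ \<one>]) force+

lemma conj_le_trans:
  assumes "conj_le G H K" "conj_le G K L" "L \<subseteq> carrier G"
  shows "conj_le G H L"
proof -
  obtain g where g: "g \<in> carrier G" "\<And>h. h \<in> H \<Longrightarrow> \<exists>k\<in>K. h = g \<otimes> k \<otimes> inv g"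
    using assms(1) unfolding conj_le_iff by blast
  obtain f where f: "f \<in> carrier G" "\<And>k. k \<in> K \<Longrightarrow> \<exists>l\<in>L. k = f \<otimes> l \<otimes> inv f"
    using assms(2) unfolding conj_le_iff by blast
  have "\<exists>l\<in>L. h = (g \<otimes> f) \<otimes> l \<otimes> inv (g \<otimes> f)" if h: "h \<in> H" for h
  proof -
    obtain k where k: "k \<in> K" "h = g \<otimes> k \<otimes> inv g" using g(2)[OF h] by blast
    obtain l where l: "l \<in> L" "k = f \<otimes> l \<otimes> inv f" using f(2)[OF k(1)] by blast
    then have "l \<in> carrier G" using assms(3) by blast
    then have "h = (g \<otimes> f) \<otimes> l \<otimes> inv (g \<otimes> f)"
      using g(1) f(1) unfolding k(2) l(2) by (simp add: inv_mult_group m_assoc)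
    then show ?thesis using l(1) by blast
  qed
  then show ?thesis unfolding conj_le_iff using g(1) f(1) m_closed by blast
qed

end

section \<open>Vertex stabilizers and maximal elliptic classes\<close>

context g_tree
begin

abbreviation stab :: "'v \<Rightarrow> 'g set" where
  "stab \<equiv> stabilizer G (act T)"

text \<open>The conjugate of the stabilizer of \<open>x\<close> by \<open>g\<close> is the
  stabilizer of \<open>g x\<close>.\<close>

lemma conj_le_stab_iff:
  assumes x: "x \<in> vertices T" and H: "H \<subseteq> carrier G"
  shows "conj_le G H (stab x) \<longleftrightarrow> (\<exists>g\<in>carrier G. H \<subseteq> stab (act T g x))"
proof
  assume "conj_le G H (stab x)"
  then obtain g where g: "g \<in> carrier G" "\<And>h. h \<in> H \<Longrightarrow> \<exists>k\<in>stab x. h = g \<otimes> k \<otimes> inv g"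
    unfolding conj_le_iff by blast
  have "h \<in> stab (act T g x)" if h: "h \<in> H" for h
  proof -
    obtain k where k: "k \<in> carrier G" "act T k x = x" "h = g \<otimes> k \<otimes> inv g"
      using g(2)[OF h] unfolding stabilizer_def by blast
    have "act T h (act T g x) = act T (h \<otimes> g) x" using composition_rule[OF x] h H g(1) by auto
    also have "h \<otimes> g = g \<otimes> k" using k g(1) by (simp add: m_assoc)
    also have "act T (g \<otimes> k) x = act T g x" using composition_rule[OF x g(1) k(1)] k(2) by simp
    finally show ?thesis using h H unfolding stabilizer_def by blast
  qed
  then show "\<exists>g\<in>carrier G. H \<subseteq> stab (act T g x)" using g(1) by blast
next
  assume "\<exists>g\<in>carrier G. H \<subseteq> stab (act T g x)"
  then obtain g where g: "g \<in> carrier G" "H \<subseteq> stab (act T g x)" by blast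
  have "\<exists>k\<in>stab x. h = g \<otimes> k \<otimes> inv g" if h: "h \<in> H" for h
  proof
    have hG: "h \<in> carrier G" using h H by blast
    have fix_h: "act T h (act T g x) = act T g x" using g(2) h unfolding stabilizer_def by blast
    let ?k = "inv g \<otimes> (h \<otimes> g)"
    have "act T ?k x = act T (inv g) (act T (h \<otimes> g) x)"
      using composition_rule[OF x] g(1) hG by simp
    also have "\<dots> = x" using composition_rule[OF x hG g(1)] fix_h act_inv(1)[OF g(1) x] by simp
    finally show "?k \<in> stab x" using g(1) hG unfolding stabilizer_def by simp
    have "g \<otimes> ?k = h \<otimes> g" using g(1) hG by (simp add: m_assoc[symmetric])
    then show "h = g \<otimes> ?k \<otimes> inv g" using g(1) hG by (simp add: m_assoc)
  qed
  then show "conj_le G H (stab x)" unfolding conj_le_iff using g(1) by blast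
qed

lemma stab_subset: "stab x \<subseteq> carrier G"
  unfolding stabilizer_def by blast

lemma stab_elliptic: "x \<in> vertices T \<Longrightarrow> stab x \<in> elliptic_subgroups G T"
  unfolding elliptic_iff using stabilizer_subgroup by blast

lemma elliptic_subset: "H \<in> elliptic_subgroups G T \<Longrightarrow> H \<subseteq> carrier G"
  unfolding elliptic_iff using subgroup.subset by blast

lemma conj_le_stab_orbit:
  assumes "x \<in> vertices T" "y \<in> vertices T" "vorbit x = vorbit y"
  shows "conj_le G (stab x) (stab y)"
  using assms conj_le_stab_iff[OF assms(2) stab_subset, of x] vorbit_eq_iff[OF assms(2,1)] by auto

text \<open>The equivalence used in \<open>elliptic_classes\<close>, expressed through the single
  tree \<open>T\<close>; the two coincide when \<open>D\<close> has the elliptic subgroups of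
  \<open>T\<close>.\<close>

definition conj_rel :: "('g set \<times> 'g set) set" where
  "conj_rel = {(H, K). H \<in> elliptic_subgroups G T \<and> K \<in> elliptic_subgroups G T \<and>
     conj_le G H K \<and> conj_le G K H}"

lemma equiv_conj_rel: "equiv (elliptic_subgroups G T) conj_rel"
proof (rule equivI)
  show "conj_rel \<subseteq> elliptic_subgroups G T \<times> elliptic_subgroups G T" by (auto simp: conj_rel_def)
  show "refl_on (elliptic_subgroups G T) conj_rel"
    unfolding refl_on_def conj_rel_def using conj_le_mono elliptic_subset by blast
  show "sym conj_rel" unfolding sym_def conj_rel_def by blast
  show "trans conj_rel"
    unfolding trans_def conj_rel_def using conj_le_trans elliptic_subset by blast
qed

text \<open>The order on classes does not depend on representatives, and classes are equal exactly
  when representatives dominate each other. So maximality of a class becomes maximality of a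
  subgroup in the preorder \<open>conj_le\<close>.\<close>

lemma vertical_set_eq:
  assumes D: "elliptics G D = elliptic_subgroups G T"
  shows "vertical_set G D = {conj_rel `` {H} | H. H \<in> elliptic_subgroups G T \<and>
    (\<forall>K\<in>elliptic_subgroups G T. conj_le G H K \<longrightarrow> conj_le G K H)}"
proof -
  let ?E = "elliptic_subgroups G T"
  have classes: "elliptic_classes G D = {conj_rel `` {H} | H. H \<in> ?E}"
    unfolding elliptic_classes_def D conj_rel_def[symmetric] quotient_def by blast
  have mem: "K \<in> conj_rel `` {H} \<longleftrightarrow> H \<in> ?E \<and> K \<in> ?E \<and> conj_le G H K \<and> conj_le G K H" for H K
    by (auto simp: conj_rel_def)
  have le: "class_le G (conj_rel `` {H}) (conj_rel `` {K}) \<longleftrightarrow> conj_le G H K"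
    if HK: "H \<in> ?E" "K \<in> ?E" for H K
  proof
    assume "class_le G (conj_rel `` {H}) (conj_rel `` {K})"
    then obtain H' K' where "H' \<in> conj_rel `` {H}" "K' \<in> conj_rel `` {K}" "conj_le G H' K'"
      unfolding class_le_def by blast
    then have *: "H' \<in> ?E" "K' \<in> ?E" "conj_le G H H'" "conj_le G H' K'" "conj_le G K' K"
      unfolding mem by blast+
    then have "conj_le G H K'" using conj_le_trans elliptic_subset by blast
    then show "conj_le G H K" using * HK conj_le_trans elliptic_subset by blast
  next
    assume "conj_le G H K"
    moreover have "H \<in> conj_rel `` {H}" "K \<in> conj_rel `` {K}"
      using equiv_class_self[OF equiv_conj_rel] HK by blast+
    ultimately show "class_le G (conj_rel `` {H}) (conj_rel `` {K})" unfolding class_le_def by blast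
  qed
  have eq: "conj_rel `` {K} = conj_rel `` {H} \<longleftrightarrow> conj_le G H K \<and> conj_le G K H"
    if "H \<in> ?E" "K \<in> ?E" for H K
    using eq_equiv_class_iff[OF equiv_conj_rel that(2,1)] that by (auto simp: conj_rel_def)
  have "(\<forall>Y\<in>elliptic_classes G D. class_le G (conj_rel `` {H}) Y \<longrightarrow> Y = conj_rel `` {H})
      \<longleftrightarrow> (\<forall>K\<in>?E. conj_le G H K \<longrightarrow> conj_le G K H)" if H: "H \<in> ?E" for H
  proof -
    have "(\<forall>Y\<in>elliptic_classes G D. class_le G (conj_rel `` {H}) Y \<longrightarrow> Y = conj_rel `` {H})
        \<longleftrightarrow> (\<forall>K\<in>?E. class_le G (conj_rel `` {H}) (conj_rel `` {K}) \<longrightarrow> conj_rel `` {K} = conj_rel `` {H})"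
      unfolding classes by blast
    also have "\<dots> \<longleftrightarrow> (\<forall>K\<in>?E. conj_le G H K \<longrightarrow> conj_le G K H)"
      using le[OF H] eq[OF H] by auto
    finally show ?thesis .
  qed
  then show ?thesis unfolding vertical_set_def classes by auto
qed

definition node_class :: "'v set \<Rightarrow> 'g set set" where
  "node_class n = conj_rel `` {stab (SOME x. x \<in> n)}"

lemma node_class_vorbit:
  assumes x: "x \<in> vertices T"
  shows "node_class (vorbit x) = conj_rel `` {stab x}"
proof -
  let ?y = "SOME y. y \<in> vorbit x"
  have y: "?y \<in> vorbit x" using orbit_refl[OF x] by (rule someI)
  then have "?y \<in> vertices T" using in_orbitD act_closed x by metis
  moreover from this have "vorbit x = vorbit ?y" using in_vorbit_iff[OF x] y by blast
  ultimately have "(stab ?y, stab x) \<in> conj_rel"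
    using x conj_le_stab_orbit stab_elliptic by (simp add: conj_rel_def)
  then show ?thesis unfolding node_class_def by (rule equiv_class_eq[OF equiv_conj_rel])
qed

text \<open>A maximal elliptic subgroup lies in some vertex stabilizer and is therefore equivalent
  to it, so the nodes map onto a set containing the vertical set.\<close>

lemma vertical_set_le_nodes:
  assumes D: "elliptics G D = elliptic_subgroups G T"
  shows "finite (vertical_set G D)" "card (vertical_set G D) \<le> card (nodes \<Gamma>)"
proof -
  have "vertical_set G D \<subseteq> node_class ` nodes \<Gamma>"
  proof
    fix X assume "X \<in> vertical_set G D"
    then obtain H where H: "X = conj_rel `` {H}" "H \<in> elliptic_subgroups G T"
      "\<And>K. K \<in> elliptic_subgroups G T \<Longrightarrow> conj_le G H K \<Longrightarrow> conj_le G K H"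
      unfolding vertical_set_eq[OF D] by blast
    obtain u where u: "u \<in> vertices T" "H \<subseteq> stab u" using H(2) elliptic_iff by blast
    then have "conj_le G H (stab u)" using conj_le_mono stab_subset by blast
    then have "(H, stab u) \<in> conj_rel"
      using H(2,3) stab_elliptic[OF u(1)] by (simp add: conj_rel_def)
    then have "X = node_class (vorbit u)"
      unfolding H(1) node_class_vorbit[OF u(1)] by (rule equiv_class_eq[OF equiv_conj_rel])
    then show "X \<in> node_class ` nodes \<Gamma>" using u(1) by simp
  qed
  then show "finite (vertical_set G D)" "card (vertical_set G D) \<le> card (nodes \<Gamma>)"
    using finite_quotient(1) by (auto intro: finite_surj surj_card_le)
qed

text \<open>Phrased by orbits rather than by uniqueness of the fixed vertex, so that it also holds
  when all vertices of \<open>T\<close> form one orbit.\<close>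

definition rigid :: "'v \<Rightarrow> bool" where
  "rigid x \<longleftrightarrow> (\<forall>w\<in>vertices T. conj_le G (stab x) (stab w) \<longrightarrow> vorbit w = vorbit x)"

text \<open>An elliptic subgroup above \<open>stab x\<close> lies in some \<open>stab u\<close>;
  rigidity puts \<open>u\<close> in the orbit of \<open>x\<close>, so \<open>stab u\<close> is
  conjugate to \<open>stab x\<close>.\<close>

lemma rigid_class_vertical:
  assumes D: "elliptics G D = elliptic_subgroups G T" and x: "x \<in> vertices T" "rigid x"
  shows "conj_rel `` {stab x} \<in> vertical_set G D"
proof -
  have "conj_le G K (stab x)" if K: "K \<in> elliptic_subgroups G T" "conj_le G (stab x) K" for K
  proof -
    obtain u where u: "u \<in> vertices T" "K \<subseteq> stab u" using K(1) elliptic_iff by blast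
    have Ku: "conj_le G K (stab u)" using conj_le_mono[OF u(2) stab_subset] .
    then have "conj_le G (stab x) (stab u)" using conj_le_trans[OF K(2)] stab_subset by blast
    then have "vorbit u = vorbit x" using x(2) u(1) unfolding rigid_def by blast
    then have "conj_le G (stab u) (stab x)" using conj_le_stab_orbit u(1) x(1) by blast
    then show ?thesis using conj_le_trans[OF Ku] stab_subset by blast
  qed
  then show ?thesis unfolding vertical_set_eq[OF D] using stab_elliptic[OF x(1)] by blast
qed

text \<open>On rigid nodes \<open>node_class\<close> is injective: equal classes make one stabilizer
  subconjugate to the other, and rigidity identifies the orbits.\<close>

lemma card_rigid_le:
  assumes D: "elliptics G D = elliptic_subgroups G T"
    and S: "S \<subseteq> nodes \<Gamma>" "\<And>x. x \<in> vertices T \<Longrightarrow> vorbit x \<in> S \<Longrightarrow> rigid x"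
  shows "card S \<le> card (vertical_set G D)"
proof (rule card_inj_on_le)
  show "finite (vertical_set G D)" using vertical_set_le_nodes(1)[OF D] .
  show "node_class ` S \<subseteq> vertical_set G D"
  proof
    fix X assume "X \<in> node_class ` S"
    then obtain x where "x \<in> vertices T" "vorbit x \<in> S" "X = node_class (vorbit x)" using S(1) by auto
    then show "X \<in> vertical_set G D" using node_class_vorbit rigid_class_vertical[OF D] S(2) by simp
  qed
  show "inj_on node_class S"
  proof (rule inj_onI)
    fix m n assume mn: "m \<in> S" "n \<in> S" "node_class m = node_class n"
    obtain x where x: "x \<in> vertices T" "m = vorbit x" using S(1) mn(1) by auto
    obtain y where y: "y \<in> vertices T" "n = vorbit y" using S(1) mn(2) by auto
    have "conj_rel `` {stab x} = conj_rel `` {stab y}"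
      using mn(3) x y node_class_vorbit by simp
    then have "(stab x, stab y) \<in> conj_rel"
      using eq_equiv_class_iff[OF equiv_conj_rel] stab_elliptic x(1) y(1) by blast
    then have "conj_le G (stab x) (stab y)" by (simp add: conj_rel_def)
    then show "m = n" using S(2)[OF x(1)] mn(1) x(2) y unfolding rigid_def by blast
  qed
qed

text \<open>If \<open>stab x\<close> fixed a second vertex, it would fix the first edge from
  \<open>x\<close> towards it, and that edge would have stabilizer \<open>stab x\<close>.\<close>

lemma rigid_if_no_full_edge:
  assumes x: "x \<in> vertices T"
    and edge: "\<And>w. {x, w} \<in> edges T \<Longrightarrow> stabilizer G (act_edge T) {x, w} \<noteq> stab x"
  shows "rigid x"
  unfolding rigid_def
proof (intro ballI impI)
  fix w assume w: "w \<in> vertices T" and "conj_le G (stab x) (stab w)"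
  then obtain g where g: "g \<in> carrier G" "stab x \<subseteq> stab (act T g w)"
    using conj_le_stab_iff[OF w stab_subset] by blast
  have gw: "act T g w \<in> vertices T" using act_closed[OF g(1) w] .
  have "act T g w = x"
  proof (rule ccontr)
    assume "act T g w \<noteq> x"
    then obtain a where a: "{x, a} \<in> edges T"
      "\<And>\<phi>. inj_on \<phi> (vertices T) \<Longrightarrow> \<phi> ` vertices T \<subseteq> vertices T \<Longrightarrow>
         (\<And>u v. {u, v} \<in> edges T \<Longrightarrow> {\<phi> u, \<phi> v} \<in> edges T) \<Longrightarrow>
         \<phi> x = x \<Longrightarrow> \<phi> (act T g w) = act T g w \<Longrightarrow> \<phi> a = a"
      using tree_fixed_edge[OF tree x gw] by metis
    have "stab x \<subseteq> stabilizer G (act_edge T) {x, a}"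
    proof
      fix h assume h: "h \<in> stab x"
      then have hG: "h \<in> carrier G" and hx: "act T h x = x" and hw: "act T h (act T g w) = act T g w"
        using g(2) unfolding stabilizer_def by blast+
      have "act T h a = a"
        using hG by (intro a(2) hx hw inj_prop edge_act) (auto simp: surj_prop)
      then show "h \<in> stabilizer G (act_edge T) {x, a}"
        using hG hx by (simp add: stabilizer_def act_edge_def)
    qed
    \<comment> \<open>Edge stabilizers are defined setwise; absence of inversions makes them fix
      both endpoints.\<close>
    moreover have "stabilizer G (act_edge T) {x, a} \<subseteq> stab x"
    proof
      fix h assume "h \<in> stabilizer G (act_edge T) {x, a}"
      then have hG: "h \<in> carrier G" and eq: "{act T h x, act T h a} = {x, a}"
        by (simp_all add: stabilizer_def act_edge_def)
      have "act T h x = x" using no_inversion[OF hG a(1)] eq by (auto simp: doubleton_eq_iff)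
      then show "h \<in> stab x" using hG by (simp add: stabilizer_def)
    qed
    ultimately show False using edge[OF a(1)] by blast
  qed
  then show "vorbit w = vorbit x" using vorbit_act[OF g(1) w] by simp
qed

section \<open>Valences and the bound on the number of vertices\<close>

lemma valence_eq: "valence \<Gamma> n = card {a \<in> arcs \<Gamma>. Domain a = n}"
  by (simp add: valence_def)

text \<open>In a reduced tree an edge \<open>e = xw\<close> with \<open>G\<^sub>e = G\<^sub>x\<close> projects to a loop; if its node
  has valence at most \<open>2\<close>, this loop is the whole quotient graph.\<close>

lemma low_valence_rigid:
  assumes red: "reduced G T \<or> BF_reduced G T"
    and x: "x \<in> vertices T" and val: "valence \<Gamma> (vorbit x) \<le> 2"
  shows "rigid x"
proof (rule ccontr)
  assume not_rigid: "\<not> rigid x"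
  then obtain w where w: "{x, w} \<in> edges T" "stabilizer G (act_edge T) {x, w} = stab x"
    using rigid_if_no_full_edge[OF x] by blast
  have "\<not> BF_reduced G T"
  proof
    assume "BF_reduced G T"
    then have "valence \<Gamma> (vorbit x) \<ge> 3" using w unfolding BF_reduced_def by blast
    then show False using val by simp
  qed
  then have orb: "vorbit x = vorbit w" using red w unfolding reduced_def by blast
  let ?A = "{a \<in> arcs \<Gamma>. Domain a = vorbit x}"
  have "{arc x w, arc w x} \<subseteq> ?A" using arc_in_arcs[OF w(1)] orb by (auto simp: Domain_arc)
  moreover have "card {arc x w, arc w x} = 2" using arc_neq_converse[OF w(1)] by auto
  ultimately have A: "?A = {arc x w, arc w x}"
    using val finite_quotient(2) unfolding valence_eq by (intro card_seteq[symmetric]) auto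
  \<comment> \<open>Every arc leaving this node is an arc of the loop and returns to it, so
    connectedness of \<open>T\<close> puts all vertices in one orbit, where rigidity is
    trivial.\<close>
  have "vorbit y = vorbit x" if "y \<in> vertices T" for y
    using tree x that
  proof (induction rule: tree_induct)
    case (step u z)
    have "arc u z \<in> ?A" using arc_in_arcs[OF step.hyps(2)] step.IH by (simp add: Domain_arc)
    then have "Range (arc u z) \<in> {Range (arc x w), Range (arc w x)}" unfolding A by blast
    then show ?case unfolding Range_arc using orb by auto
  qed simp
  then show False using not_rigid unfolding rigid_def by blast
qed

lemma valence_pos:
  assumes E: "edges T \<noteq> {}" and n: "n \<in> nodes \<Gamma>"
  shows "valence \<Gamma> n \<ge> 1"
proof -
  obtain x where x: "x \<in> vertices T" "n = vorbit x" using n by auto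
  obtain w where "{x, w} \<in> edges T" using tree_neighbour[OF tree E x(1)] by blast
  then have "arc x w \<in> {a \<in> arcs \<Gamma>. Domain a = n}" using arc_in_arcs x(2) by (simp add: Domain_arc)
  then have "card {a \<in> arcs \<Gamma>. Domain a = n} > 0" using finite_quotient(2) by (auto simp: card_gt_0_iff)
  then show ?thesis unfolding valence_eq by simp
qed

text \<open>The valence sum gives a lower bound for the number of arcs, and the Euler characteristic
  gives an upper bound; eliminating the arcs leaves the claim.\<close>

lemma node_bound:
  assumes D: "elliptics G D = elliptic_subgroups G T"
    and red: "reduced G T \<or> BF_reduced G T" and E: "edges T \<noteq> {}"
  shows "card (nodes \<Gamma>) + 2 \<le> 2 * card (vertical_set G D) + 2 * first_betti \<Gamma>"
proof -
  define low where "low = {n \<in> nodes \<Gamma>. valence \<Gamma> n \<le> 2}"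
  have low: "low \<subseteq> nodes \<Gamma>" by (auto simp: low_def)
  have card_low: "card low \<le> card (vertical_set G D)"
    using card_rigid_le[OF D low] low_valence_rigid[OF red] unfolding low_def by blast
  \<comment> \<open>As \<open>T\<close> has an edge, every valence is at least 1, so adding 2 at the
    nodes of \<open>low\<close> brings every term up to 3.\<close>
  have "(\<Sum>n\<in>nodes \<Gamma>. 3) \<le> (\<Sum>n\<in>nodes \<Gamma>. valence \<Gamma> n + 2 * of_bool (n \<in> low))"
    using valence_pos[OF E] by (intro sum_mono) (force simp: low_def)
  also have "\<dots> = (\<Sum>n\<in>nodes \<Gamma>. valence \<Gamma> n) + 2 * card low"
    using finite_quotient(1) low
    by (simp add: sum.distrib sum_distrib_left[symmetric] Int_absorb1 del: quotient_graph_simps)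
  also have "(\<Sum>n\<in>nodes \<Gamma>. valence \<Gamma> n) = card (arcs \<Gamma>)"
    unfolding valence_def card_eq_sum using arcs_origin
    by (intro sum_over_origins[OF finite_quotient]) simp
  finally have "3 * card (nodes \<Gamma>) \<le> card (arcs \<Gamma>) + 2 * card (vertical_set G D)"
    using card_low by simp
  moreover have "card (arcs \<Gamma>) + 2 \<le> 2 * first_betti \<Gamma> + 2 * card (nodes \<Gamma>)"
  proof (rule first_betti_lower_bound)
    show "nodes \<Gamma> \<noteq> {}" using tree unfolding simplicial_tree_def by simp
    show "origin \<Gamma> a \<in> nodes \<Gamma>" if "a \<in> arcs \<Gamma>" for a using arcs_origin[OF that] by simp
    show "rev_arc \<Gamma> a \<in> arcs \<Gamma> \<and> rev_arc \<Gamma> a \<noteq> a \<and> rev_arc \<Gamma> (rev_arc \<Gamma> a) = a"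
      if "a \<in> arcs \<Gamma>" for a using arcs_converse[OF that] by simp
  qed (rule finite_quotient)+
  ultimately show ?thesis by linarith
qed

end

text \<open>The condition \<open>edges T \<noteq> {}\<close> in the second part excludes the
  one-point tree, where there is one node, one vertical class and Betti number zero, so that the
  bound would read \<open>1 \<le> 0\<close>. Integers keep the subtraction of 2 from being
  truncated.\<close>

theorem proposition4p3:
  fixes G :: "('g, 'b) monoid_scheme" and D :: "('g, 'v) gtree set"
  assumes "group G"
    and "finitely_generated G"
    and "deformation_space G D"
  shows "(finite (vertical_set G D) \<and>
          (\<forall>T\<in>D. finite (nodes (quotient_graph G T)) \<and>
                 card (nodes (quotient_graph G T)) \<ge> card (vertical_set G D))) \<and>
         (\<forall>T\<in>D. edges T \<noteq> {} \<longrightarrow> reduced G T \<or> BF_reduced G T \<longrightarrow>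
            int (card (nodes (quotient_graph G T)))
              \<le> 2 * int (card (vertical_set G D)) + 2 * int (betti_number G D) - 2)"
proof -
  obtain T0 :: "('g, 'v) gtree" where T0: "G_tree G T0"
    "D = {T. G_tree G T \<and> elliptic_subgroups G T = elliptic_subgroups G T0}"
    using assms(3) unfolding deformation_space_def by blast
  have in_D: "T0 \<in> D" using T0 by blast
  have g_tree: "g_tree G T" and same: "elliptic_subgroups G T = elliptic_subgroups G T0" if "T \<in> D" for T
    using that assms(1,2) T0(2) by (auto simp: g_tree_def g_tree_axioms_def)
  have D: "elliptics G D = elliptic_subgroups G T" if "T \<in> D" for T
    unfolding elliptics_def using same that by auto
  \<comment> \<open>The Betti number is constant on \<open>D\<close>, so the definite description in
    \<open>betti_number\<close> denotes the common value.\<close>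
  have betti: "betti_number G D = first_betti (quotient_graph G T)" if "T \<in> D" for T
    unfolding betti_number_def
  proof (rule the_equality)
    show "\<forall>T'\<in>D. first_betti (quotient_graph G T') = first_betti (quotient_graph G T)"
      using first_betti_eq g_tree same that by metis
  qed (use that in auto)
  have "finite (vertical_set G D)"
    using g_tree.vertical_set_le_nodes(1)[OF g_tree D] in_D by blast
  moreover have "finite (nodes (quotient_graph G T))"
    "card (vertical_set G D) \<le> card (nodes (quotient_graph G T))" if "T \<in> D" for T
    using g_tree.finite_quotient(1) g_tree.vertical_set_le_nodes(2)[OF g_tree D] g_tree that by blast+
  moreover have "int (card (nodes (quotient_graph G T)))
      \<le> 2 * int (card (vertical_set G D)) + 2 * int (betti_number G D) - 2"
    if "T \<in> D" "edges T \<noteq> {}" "reduced G T \<or> BF_reduced G T" for T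
    using g_tree.node_bound[OF g_tree D] that betti by fastforce
  ultimately show ?thesis by blast
qed

end
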